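(* Let $I$ be a homogeneous ideal in $S$, and write $I=(x_1,\ldots,x_m)$ with each $x_j$ homogeneous. Fix $i\ge 0$. Then there exists a Cartan $S$-module structure (depending on $\mathbf x=x_1,\ldots,x_m$) on the local cohomology module $H^i_I(S)$.
   Context: Let $q=p^s$ be a power of a prime $p$, $\mathbb F_q$ the field with $q$ elements, $V$ a $d$-dimensional $\mathbb F_q$-vector space, and $G$ a subgroup of $GL(V)$. Let $R=\mathbb F_q[V]=\operatorname{Sym}_{\mathbb F_q}(V^* )$, graded with $V^*$ in degree $1$, with the natural action of $G$, and let $S=R^G$. Steenrod operators: let $P(\xi)\colon R\to R[\xi]$ be the $\mathbb F_q$-algebra homomorphism with $P(\xi)(v)=v+v^q\xi$ for all $v\in V^*$, and define $\mathbb F_q$-linear maps $\mathcal P^i\colon R\to R$ ($i\ge 0$) by $P(\xi)(f)=\sum_{i\ge0}\mathcal P^i(f)\xi^i$; these commute with the $G$-action and restrict to maps $\mathcal P^i\colon S\to S$. A Cartan $S$-module is an $S$-module $M$ equipped with $\mathbb F_q$-linear maps $\mathcal Q^i_M\colon M\to M$ for $i\ge 0$, with $\mathcal Q^0_M$ the identity, such that $\mathcal Q^r_M(s\alpha)=\sum_{i+j=r}\mathcal P^i(s)\mathcal Q^j_M(\alpha)$ for all $s\in S$, $\alpha\in M$ and $r\ge 1$. *)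

theory Defs
  imports
    "HOL-Algebra.Module"
    "HOL-Algebra.Ideal_Product"
    "HOL-Library.Cardinality"
    "HOL-Library.Poly_Mapping"
    "HOL-Computational_Algebra.Computational_Algebra"
begin

hide_const (open) Multiset.mult Polynomial.smult

section \<open>The symmetric algebra of the dual space\<close>

text \<open>
  The finite field is a type \<open>'k\<close> of class \<open>finite_field\<close>, so that \<open>q = CARD('k)\<close>.
  The space \<open>V\<close> is the type \<open>'v\<close> with scalar multiplication \<open>scale\<close> and a finite basis \<open>B\<close>
  (\<open>finite_dimensional_vector_space scale B\<close>; \<open>B\<close> may be empty).  The algebra \<open>Sym(V*)\<close> is the
  polynomial ring over \<open>'k\<close> in the dual basis of \<open>B\<close>: the variable indexed by \<open>b \<in> B\<close> is the
  coordinate functional of \<open>b\<close>, and a linear functional \<open>l\<close> on \<open>V\<close> is the linear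
  form \<open>lin_form B l\<close>.
\<close>

type_synonym ('v, 'k) mpoly = "('v \<Rightarrow>\<^sub>0 nat) \<Rightarrow>\<^sub>0 'k"

definition mp_const :: "'k \<Rightarrow> ('v, 'k::comm_ring_1) mpoly" where
  "mp_const c = Poly_Mapping.single 0 c"

definition mp_var :: "'v \<Rightarrow> ('v, 'k::comm_ring_1) mpoly" where
  "mp_var b = Poly_Mapping.single (Poly_Mapping.single b 1) 1"

text \<open>The ring homomorphism that is \<open>\<phi>\<close> on constants and maps the variable \<open>b\<close> to \<open>\<theta> b\<close>.\<close>

definition mp_subst ::
    "('k \<Rightarrow> 'a) \<Rightarrow> ('v \<Rightarrow> 'a) \<Rightarrow> ('v, 'k::comm_ring_1) mpoly \<Rightarrow> 'a::comm_ring_1" where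
  "mp_subst \<phi> \<theta> f =
     (\<Sum>m\<in>Poly_Mapping.keys f.
        \<phi> (Poly_Mapping.lookup f m) * (\<Prod>b\<in>Poly_Mapping.keys m. \<theta> b ^ Poly_Mapping.lookup m b))"

definition lin_form :: "'v set \<Rightarrow> ('v \<Rightarrow> 'k) \<Rightarrow> ('v, 'k::comm_ring_1) mpoly" where
  "lin_form B l = (\<Sum>b\<in>B. mp_const (l b) * mp_var b)"

definition sym_ring :: "'v set \<Rightarrow> ('v, 'k::comm_ring_1) mpoly ring" where
  "sym_ring B =
     \<lparr>carrier = {f. \<forall>m\<in>Poly_Mapping.keys f. Poly_Mapping.keys m \<subseteq> B},
      mult = (*), one = 1, zero = 0, add = (+)\<rparr>"

definition mon_degree :: "('v \<Rightarrow>\<^sub>0 nat) \<Rightarrow> nat" where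
  "mon_degree m = (\<Sum>b\<in>Poly_Mapping.keys m. Poly_Mapping.lookup m b)"

definition homogeneous :: "('v, 'k::comm_ring_1) mpoly \<Rightarrow> bool" where
  "homogeneous f \<longleftrightarrow> (\<exists>n. \<forall>m\<in>Poly_Mapping.keys f. mon_degree m = n)"

definition hom_component :: "nat \<Rightarrow> ('v, 'k::comm_ring_1) mpoly \<Rightarrow> ('v, 'k) mpoly" where
  "hom_component n f =
     (\<Sum>m\<in>{m \<in> Poly_Mapping.keys f. mon_degree m = n}.
        Poly_Mapping.single m (Poly_Mapping.lookup f m))"

section \<open>Invariants\<close>

definition general_linear_group ::
    "('k::field \<Rightarrow> 'v::ab_group_add \<Rightarrow> 'v) \<Rightarrow> ('v \<Rightarrow> 'v) monoid" where
  "general_linear_group scale =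
     \<lparr>carrier = {g. Vector_Spaces.linear scale scale g \<and> bij g}, mult = (\<circ>), one = id\<rparr>"

text \<open>
  The action on functionals is contragredient, \<open>(g l)(v) = l (inv_into UNIV g v)\<close>, and is extended to an
  action by algebra automorphisms.  The functional \<open>\<lambda>v. Modules.module.representation scale B v b\<close> is
  the coordinate functional of \<open>b\<close>.
\<close>

definition sym_act ::
    "('k::field \<Rightarrow> 'v::ab_group_add \<Rightarrow> 'v) \<Rightarrow> 'v set \<Rightarrow> ('v \<Rightarrow> 'v)
      \<Rightarrow> ('v, 'k) mpoly \<Rightarrow> ('v, 'k) mpoly" where
  "sym_act scale B g =
     mp_subst mp_const (\<lambda>b. lin_form B (\<lambda>v. Modules.module.representation scale B (inv_into UNIV g v) b))"

definition invariant_ring ::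
    "('k::field \<Rightarrow> 'v::ab_group_add \<Rightarrow> 'v) \<Rightarrow> 'v set \<Rightarrow> ('v \<Rightarrow> 'v) set
      \<Rightarrow> ('v, 'k) mpoly ring" where
  "invariant_ring scale B G =
     (sym_ring B)\<lparr>carrier := {f \<in> carrier (sym_ring B). \<forall>g\<in>G. sym_act scale B g f = f}\<rparr>"

definition homogeneous_ideal ::
    "('v, 'k::comm_ring_1) mpoly set \<Rightarrow> ('v, 'k) mpoly ring \<Rightarrow> bool" where
  "homogeneous_ideal I S \<longleftrightarrow> ideal I S \<and> (\<forall>f\<in>I. \<forall>n. hom_component n f \<in> I)"

section \<open>Steenrod operators\<close>

definition steenrod_total :: "('v, 'k::finite_field) mpoly \<Rightarrow> ('v, 'k) mpoly poly" where
  "steenrod_total =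
     mp_subst (\<lambda>c. [:mp_const c:]) (\<lambda>b. [:mp_var b, mp_var b ^ CARD('k):])"

definition steenrod :: "nat \<Rightarrow> ('v, 'k::finite_field) mpoly \<Rightarrow> ('v, 'k) mpoly" where
  "steenrod i f = poly.coeff (steenrod_total f) i"

subsection \<open>The defining properties on linear forms\<close>

lemma mp_subst_supset:
  assumes "finite A" "Poly_Mapping.keys f \<subseteq> A" "\<phi> 0 = 0"
  shows "mp_subst \<phi> \<theta> f =
     (\<Sum>m\<in>A. \<phi> (Poly_Mapping.lookup f m)
        * (\<Prod>b\<in>Poly_Mapping.keys m. \<theta> b ^ Poly_Mapping.lookup m b))"
  unfolding mp_subst_def
  by (rule sum.mono_neutral_left) (use assms in \<open>auto simp: in_keys_iff\<close>)

lemma mp_subst_add: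
  assumes "\<And>a b. \<phi> (a + b) = \<phi> a + \<phi> b"
  shows "mp_subst \<phi> \<theta> (f + g) = mp_subst \<phi> \<theta> f + mp_subst \<phi> \<theta> g"
proof -
  let ?A = "Poly_Mapping.keys f \<union> Poly_Mapping.keys g"
  have 0: "\<phi> 0 = 0" using assms[of 0 0] by simp
  have "Poly_Mapping.keys (f + g) \<subseteq> ?A" by (rule keys_add)
  then show ?thesis
    using mp_subst_supset[of ?A f \<phi> \<theta>] mp_subst_supset[of ?A g \<phi> \<theta>]
      mp_subst_supset[of ?A "f + g" \<phi> \<theta>] 0
    by (simp add: lookup_add assms ring_distribs sum.distrib)
qed

lemma mp_subst_sum:
  assumes "\<And>a b. \<phi> (a + b) = \<phi> a + \<phi> b"
  shows "mp_subst \<phi> \<theta> (\<Sum>x\<in>A. h x) = (\<Sum>x\<in>A. mp_subst \<phi> \<theta> (h x))"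
proof (induction A rule: infinite_finite_induct)
  case (insert x F)
  then show ?case by (simp add: mp_subst_add[OF assms])
qed (simp_all add: mp_subst_def)

lemma mon_value_add:
  fixes \<theta> :: "'v \<Rightarrow> 'a::comm_ring_1"
  shows "(\<Prod>b\<in>Poly_Mapping.keys (m + n). \<theta> b ^ Poly_Mapping.lookup (m + n) b) =
    (\<Prod>b\<in>Poly_Mapping.keys m. \<theta> b ^ Poly_Mapping.lookup m b) *
    (\<Prod>b\<in>Poly_Mapping.keys n. \<theta> b ^ Poly_Mapping.lookup n b)"
proof -
  let ?A = "Poly_Mapping.keys m \<union> Poly_Mapping.keys n"
  have *: "(\<Prod>b\<in>Poly_Mapping.keys k. \<theta> b ^ Poly_Mapping.lookup k b) =
      (\<Prod>b\<in>?A. \<theta> b ^ Poly_Mapping.lookup k b)" if "Poly_Mapping.keys k \<subseteq> ?A" for k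
    by (rule prod.mono_neutral_left) (use that in \<open>auto simp: in_keys_iff\<close>)
  have "(\<Prod>b\<in>Poly_Mapping.keys (m + n). \<theta> b ^ Poly_Mapping.lookup (m + n) b) =
      (\<Prod>b\<in>?A. \<theta> b ^ Poly_Mapping.lookup m b) * (\<Prod>b\<in>?A. \<theta> b ^ Poly_Mapping.lookup n b)"
    by (subst *[OF keys_add]) (simp add: lookup_add power_add prod.distrib)
  then show ?thesis
    by (simp only: *[OF Un_upper1] *[OF Un_upper2])
qed

lemma mp_subst_single:
  assumes "\<phi> 0 = 0"
  shows "mp_subst \<phi> \<theta> (Poly_Mapping.single m c) =
    \<phi> c * (\<Prod>b\<in>Poly_Mapping.keys m. \<theta> b ^ Poly_Mapping.lookup m b)"
  using assms by (simp add: mp_subst_def)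

lemma mp_subst_const:
  assumes "\<phi> 0 = 0"
  shows "mp_subst \<phi> \<theta> (mp_const c) = \<phi> c"
  using assms by (simp add: mp_const_def mp_subst_single)

lemma mp_subst_var:
  assumes "\<phi> 0 = 0" "\<phi> 1 = 1"
  shows "mp_subst \<phi> \<theta> (mp_var b) = \<theta> b"
  using assms by (simp add: mp_var_def mp_subst_single)

lemma mp_expand: "f = (\<Sum>m\<in>Poly_Mapping.keys f. Poly_Mapping.single m (Poly_Mapping.lookup f m))"
  by (rule poly_mapping_eqI) (auto simp: lookup_sum lookup_single when_def in_keys_iff)

lemma mp_subst_mult:
  assumes add: "\<And>a b. \<phi> (a + b) = \<phi> a + \<phi> b" and mult: "\<And>a b. \<phi> (a * b) = \<phi> a * \<phi> b"
  shows "mp_subst \<phi> \<theta> (f * g) = mp_subst \<phi> \<theta> f * mp_subst \<phi> \<theta> g"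
proof -
  have 0: "\<phi> 0 = 0" using add[of 0 0] by simp
  let ?s = "\<lambda>f m. Poly_Mapping.single m (Poly_Mapping.lookup f m)"
  have "mp_subst \<phi> \<theta> (f * g) =
      mp_subst \<phi> \<theta> (\<Sum>m\<in>Poly_Mapping.keys f. \<Sum>n\<in>Poly_Mapping.keys g. ?s f m * ?s g n)"
    by (subst (1) mp_expand[of f], subst (1) mp_expand[of g]) (simp add: sum_product)
  also have "\<dots> = (\<Sum>m\<in>Poly_Mapping.keys f. \<Sum>n\<in>Poly_Mapping.keys g.
      mp_subst \<phi> \<theta> (?s f m) * mp_subst \<phi> \<theta> (?s g n))"
    by (simp add: mp_subst_sum[OF add] mult_single mp_subst_single[of \<phi>, OF 0] mult mon_value_add mult_ac)
  also have "\<dots> = mp_subst \<phi> \<theta> f * mp_subst \<phi> \<theta> g"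
    by (subst (3) mp_expand[of f], subst (3) mp_expand[of g])
      (simp add: sum_product mp_subst_sum[OF add])
  finally show ?thesis .
qed

lemma mp_const_add: "mp_const (a + b) = mp_const a + mp_const b"
  and mp_const_mult: "mp_const (a * b) = mp_const a * mp_const b"
  and mp_const_0: "mp_const 0 = 0"
  and mp_const_1: "mp_const 1 = 1"
  and mp_const_of_nat: "mp_const (of_nat n) = of_nat n"
  by (simp_all add: mp_const_def single_add mult_single)

lemma mp_const_power: "mp_const (a ^ n) = mp_const a ^ n"
  by (induction n) (simp_all add: mp_const_1 mp_const_mult)

lemma mp_const_sum: "mp_const (\<Sum>x\<in>A. h x) = (\<Sum>x\<in>A. mp_const (h x))"
  by (induction A rule: infinite_finite_induct) (simp_all add: mp_const_0 mp_const_add)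

lemma steenrod_total_add: "steenrod_total (f + g) = steenrod_total f + steenrod_total g"
  unfolding steenrod_total_def by (rule mp_subst_add) (simp add: mp_const_add)

lemma steenrod_total_mult: "steenrod_total (f * g) = steenrod_total f * steenrod_total g"
  unfolding steenrod_total_def by (rule mp_subst_mult) (simp_all add: mp_const_add mp_const_mult)

lemma steenrod_total_const: "steenrod_total (mp_const c) = [:mp_const c:]"
  unfolding steenrod_total_def by (rule mp_subst_const) (simp add: mp_const_0)

lemma binomial_card_eq_0:
  assumes "0 < k" "k < CARD('k::finite_field)"
  shows "(of_nat (CARD('k) choose k) :: 'k) = 0"
proof -
  let ?q = "CARD('k)"
  let ?p = "\<Sum>k\<in>{0<..<?q}. monom (of_nat (?q choose k) :: 'k) k"
  have "poly ?p x = 0" for x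
  proof -
    have "{..?q} = insert 0 (insert ?q {0<..<?q})" using finite_UNIV_card_ge_0[where ?'a='k] by auto
    then have "(x + 1) ^ ?q = 1 + x ^ ?q + (\<Sum>k\<in>{0<..<?q}. of_nat (?q choose k) * x ^ k)"
      by (subst binomial_ring) (simp add: finite_UNIV_card_ge_0)
    then show ?thesis
      unfolding finite_field_power_card_eq_same by (simp add: poly_sum poly_monom)
  qed
  moreover have "degree ?p < ?q"
    by (rule degree_sum_less) (use assms in \<open>auto intro: le_less_trans[OF degree_monom_le]\<close>)
  ultimately have "?p = 0"
    by (metis (mono_tags, lifting) UNIV_I Collect_cong UNIV_def card_poly_roots_bound linorder_not_less)
  then have "poly.coeff ?p k = 0" by simp
  then show ?thesis using assms by (simp add: coeff_sum)
qed

lemma mp_add_power_card: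
  fixes f g :: "('v, 'k::finite_field) mpoly"
  shows "(f + g) ^ CARD('k) = f ^ CARD('k) + g ^ CARD('k)"
proof -
  let ?q = "CARD('k)"
  have *: "{..?q} = insert 0 (insert ?q {0<..<?q})" using finite_UNIV_card_ge_0[where ?'a='k] by auto
  have "of_nat (?q choose k) = (0 :: ('v, 'k) mpoly)" if "k \<in> {0<..<?q}" for k
    using that binomial_card_eq_0[where ?'k='k, of k]
    by (metis greaterThanLessThan_iff mp_const_0 mp_const_of_nat)
  then show ?thesis
    by (subst binomial_ring) (simp add: * finite_UNIV_card_ge_0 add.commute)
qed

theorem steenrod_total_lin_form:
  fixes l :: "'v \<Rightarrow> 'k::finite_field"
  shows "steenrod_total (lin_form B l) = [:lin_form B l, lin_form B l ^ CARD('k):]"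
proof (cases "finite B")
  case True
  have pow: "(\<Sum>b\<in>A. h b) ^ CARD('k) = (\<Sum>b\<in>A. h b ^ CARD('k))"
    for h :: "'v \<Rightarrow> ('v, 'k) mpoly" and A
    by (induction A rule: infinite_finite_induct) (simp_all add: mp_add_power_card power_0_left)
  have var: "steenrod_total (mp_var b :: ('v, 'k) mpoly) = [:mp_var b, mp_var b ^ CARD('k):]"
    for b :: 'v unfolding steenrod_total_def by (rule mp_subst_var) (simp_all add: mp_const_0 mp_const_1)
  from True show ?thesis
  proof (induction B rule: finite_induct)
    case empty
    then show ?case by (simp add: lin_form_def steenrod_total_def mp_subst_def power_0_left)
  next
    case (insert x F)
    have "lin_form (insert x F) l = mp_const (l x) * mp_var x + lin_form F l"
      using insert by (simp add: lin_form_def)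
    then show ?case
      using insert.IH
      by (simp add: steenrod_total_add steenrod_total_mult steenrod_total_const var
          mp_add_power_card power_mult_distrib finite_field_power_card_eq_same
          flip: mp_const_power)
  qed
qed (simp add: lin_form_def steenrod_total_def mp_subst_def power_0_left)

theorem sym_act_lin_form:
  fixes scale :: "'k::field \<Rightarrow> 'v::ab_group_add \<Rightarrow> 'v"
  assumes "finite_dimensional_vector_space scale B" "Vector_Spaces.linear scale (*) l"
  shows "sym_act scale B g (lin_form B l) = lin_form B (\<lambda>v. l (inv_into UNIV g v))"
proof -
  interpret fd: finite_dimensional_vector_space scale B by fact
  interpret l: Vector_Spaces.linear scale "(*)" l by fact
  have rep: "l v = (\<Sum>b\<in>B. fd.representation B v b * l b)" for v
    by (subst fd.sum_representation_eq[symmetric, of B v B])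
      (simp_all add: fd.independent_Basis fd.span_Basis fd.finite_Basis l.sum l.scale)
  have "sym_act scale B g (lin_form B l) =
      (\<Sum>b\<in>B. mp_const (l b) * lin_form B (\<lambda>v. fd.representation B (inv_into UNIV g v) b))"
    unfolding sym_act_def lin_form_def
    by (simp add: mp_subst_sum mp_subst_mult mp_const_add mp_const_mult mp_subst_const
        mp_subst_var mp_const_0 mp_const_1)
  also have "\<dots> = lin_form B (\<lambda>v. l (inv_into UNIV g v))"
    unfolding lin_form_def sum_distrib_left
    by (subst sum.swap, subst rep)
      (simp add: mp_const_sum mp_const_mult sum_distrib_right sum_distrib_left mult_ac)
  finally show ?thesis .
qed

section \<open>Cartan modules\<close>

definition mod_hom ::
    "('s, 'r) ring_scheme \<Rightarrow> ('s, 'a) module \<Rightarrow> ('s, 'b) module \<Rightarrow> ('a \<Rightarrow> 'b) set" where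
  "mod_hom S M N =
     {f \<in> carrier M \<rightarrow> carrier N.
        (\<forall>x\<in>carrier M. \<forall>y\<in>carrier M. f (x \<oplus>\<^bsub>M\<^esub> y) = f x \<oplus>\<^bsub>N\<^esub> f y) \<and>
        (\<forall>s\<in>carrier S. \<forall>x\<in>carrier M. f (s \<odot>\<^bsub>M\<^esub> x) = s \<odot>\<^bsub>N\<^esub> f x)}"

definition cartan_module ::
    "('v, 'k::finite_field) mpoly ring \<Rightarrow> (('v, 'k) mpoly, 'm) module
      \<Rightarrow> (nat \<Rightarrow> 'm \<Rightarrow> 'm) \<Rightarrow> bool" where
  "cartan_module S M Q \<longleftrightarrow>
     Module.module S M \<and>
     (\<forall>i. Q i \<in> carrier M \<rightarrow> carrier M \<and>
        (\<forall>x\<in>carrier M. \<forall>y\<in>carrier M. Q i (x \<oplus>\<^bsub>M\<^esub> y) = Q i x \<oplus>\<^bsub>M\<^esub> Q i y) \<and>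
        (\<forall>c. \<forall>x\<in>carrier M. Q i (mp_const c \<odot>\<^bsub>M\<^esub> x) = mp_const c \<odot>\<^bsub>M\<^esub> Q i x)) \<and>
     (\<forall>x\<in>carrier M. Q 0 x = x) \<and>
     (\<forall>r\<ge>1. \<forall>s\<in>carrier S. \<forall>x\<in>carrier M.
        Q r (s \<odot>\<^bsub>M\<^esub> x) = (\<Oplus>\<^bsub>M\<^esub> i\<in>{0..r}. steenrod i s \<odot>\<^bsub>M\<^esub> Q (r - i) x))"

section \<open>Local cohomology\<close>

text \<open>
  Local cohomology is the right derived functor of the torsion functor, computed from an
  injective resolution.  Only the additive structure and the scalar multiplication of a module
  record are meaningful; its \<open>mult\<close> and \<open>one\<close> fields are junk.
\<close>

definition ring_as_module :: "'s ring \<Rightarrow> ('s, 's) module" where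
  "ring_as_module S =
     \<lparr>carrier = carrier S, mult = mult S, one = one S, zero = zero S, add = add S,
      smult = mult S\<rparr>"

text \<open>
  HOL cannot quantify over the types carrying the test modules \<open>X\<close> and \<open>Y\<close>.  The type
  \<open>('s + 'e) list\<close> is large enough that nothing is lost: up to isomorphism it contains all modules
  whose cardinality is at most that of the ring or of \<open>'e\<close>, in particular all ideals of the
  ring, so by Baer's criterion \<open>E\<close> has the lifting property against modules over every type.
\<close>

definition injective_module :: "'s ring \<Rightarrow> ('s, 'e) module \<Rightarrow> bool" where
  "injective_module S E \<longleftrightarrow>
     Module.module S E \<and>
     (\<forall>(X :: ('s, ('s + 'e) list) module) (Y :: ('s, ('s + 'e) list) module) f g.
        Module.module S X \<longrightarrow> Module.module S Y \<longrightarrow>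
        f \<in> mod_hom S X Y \<longrightarrow> inj_on f (carrier X) \<longrightarrow> g \<in> mod_hom S X E \<longrightarrow>
        (\<exists>h\<in>mod_hom S Y E. \<forall>x\<in>carrier X. h (f x) = g x))"

definition mod_ker :: "('s, 'a) module \<Rightarrow> ('s, 'b) module \<Rightarrow> ('a \<Rightarrow> 'b) \<Rightarrow> 'a set" where
  "mod_ker M N f = {x \<in> carrier M. f x = \<zero>\<^bsub>N\<^esub>}"

definition injective_resolution ::
    "'s ring \<Rightarrow> ('s, 'a) module \<Rightarrow> (nat \<Rightarrow> ('s, 'e) module) \<Rightarrow> ('a \<Rightarrow> 'e)
      \<Rightarrow> (nat \<Rightarrow> 'e \<Rightarrow> 'e) \<Rightarrow> bool" where
  "injective_resolution S M E \<epsilon> d \<longleftrightarrow>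
     Module.module S M \<and>
     (\<forall>n. injective_module S (E n)) \<and>
     \<epsilon> \<in> mod_hom S M (E 0) \<and>
     (\<forall>n. d n \<in> mod_hom S (E n) (E (Suc n))) \<and>
     inj_on \<epsilon> (carrier M) \<and>
     \<epsilon> ` carrier M = mod_ker (E 0) (E 1) (d 0) \<and>
     (\<forall>n. d n ` carrier (E n) = mod_ker (E (Suc n)) (E (Suc (Suc n))) (d (Suc n)))"

definition torsion_submodule ::
    "'s ring \<Rightarrow> 's set \<Rightarrow> ('s, 'e) module \<Rightarrow> ('s, 'e) module" where
  "torsion_submodule S I M =
     M\<lparr>carrier := {x \<in> carrier M. \<exists>n::nat. \<forall>a \<in> I [^]\<^bsub>ideals_set S\<^esub> n. a \<odot>\<^bsub>M\<^esub> x = \<zero>\<^bsub>M\<^esub>}\<rparr>"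

definition quotient_module :: "('s, 'e) module \<Rightarrow> 'e set \<Rightarrow> ('s, 'e set) module" where
  "quotient_module M N =
     \<lparr>carrier = a_rcosets\<^bsub>M\<^esub> N, mult = undefined, one = undefined, zero = N, add = set_add M,
      smult = (\<lambda>a X. \<Union>x\<in>X. N +>\<^bsub>M\<^esub> (a \<odot>\<^bsub>M\<^esub> x))\<rparr>"

definition coboundaries ::
    "(nat \<Rightarrow> ('s, 'e) module) \<Rightarrow> (nat \<Rightarrow> 'e \<Rightarrow> 'e) \<Rightarrow> nat \<Rightarrow> 'e set" where
  "coboundaries C d i =
     (case i of 0 \<Rightarrow> {\<zero>\<^bsub>C 0\<^esub>} | Suc j \<Rightarrow> d j ` carrier (C j))"

definition cohomology ::
    "(nat \<Rightarrow> ('s, 'e) module) \<Rightarrow> (nat \<Rightarrow> 'e \<Rightarrow> 'e) \<Rightarrow> nat \<Rightarrow> ('s, 'e set) module" where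
  "cohomology C d i =
     quotient_module ((C i)\<lparr>carrier := mod_ker (C i) (C (Suc i)) (d i)\<rparr>) (coboundaries C d i)"

definition local_cohomology ::
    "'s ring \<Rightarrow> 's set \<Rightarrow> (nat \<Rightarrow> ('s, 'e) module) \<Rightarrow> (nat \<Rightarrow> 'e \<Rightarrow> 'e) \<Rightarrow> nat
      \<Rightarrow> ('s, 'e set) module" where
  "local_cohomology S I E d i = cohomology (\<lambda>n. torsion_submodule S I (E n)) d i"

end

theory Submission
  imports Defs
begin

text \<open>
  A Cartan structure on an \<open>S\<close>-module \<open>M\<close> is an additive map \<open>Q(\<xi>) : M \<rightarrow> M[[\<xi>]]\<close> that is the identity
  modulo \<open>\<xi>\<close> and semilinear along \<open>P(\<xi>) : S \<rightarrow> S[\<xi>]\<close>.  The argument rests on \<open>P(\<xi>)\<close>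
  being a ring homomorphism that reduces to the identity modulo \<open>\<xi>\<close>, that is, on its coefficients
  forming a Hasse--Schmidt derivation of \<open>S\<close>.  The proof works for such a derivation \<open>D\<close> on any commutative
  ring, and constructs the operators on local cohomology from the injective resolution itself.

  Let \<open>E\<close> be an injective module, and let \<open>E[[\<xi>]]\<close> be an \<open>S\<close>-module through \<open>s \<mapsto> \<Sum> D\<^sub>i(s) \<xi>\<^sup>i\<close>.
  Since \<open>D\<^sub>0\<close> is the identity, the quotients of the \<open>\<xi>\<close>-adic filtration of \<open>E[[\<xi>]]\<close> are copies of \<open>E\<close> with
  its ordinary structure.  All the extensions by which \<open>E[[\<xi>]]\<close> is built up from them therefore split,
  and \<open>E[[\<xi>]]\<close> has the lifting property of an injective module, one coefficient at a time.  Hence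
  compatible operators on a submodule of \<open>E\<close> extend to \<open>E\<close> (\<open>extend_compatible\<close>).  As in the
  comparison theorem for resolutions, this lifts \<open>D\<close> on \<open>S\<close> to compatible operators on every term of an
  injective resolution that commute with the differentials (\<open>compatible_resolution\<close>).

  The operators preserve \<open>I\<close>-torsion.  Indeed \<open>D\<^sub>i\<close> maps \<open>I\<^sup>m\<close> into \<open>I\<^sup>m\<^sup>-\<^sup>i\<close> (\<open>D_ideal_power\<close>), so solving
  \<open>Q\<^sub>n(a x) = \<Sum> D\<^sub>i(a) Q\<^sub>n\<^sub>-\<^sub>i(x)\<close> for \<open>a Q\<^sub>n(x)\<close> shows by induction on \<open>n\<close> that \<open>I\<^sup>N\<^sup>+\<^sup>n\<close> kills \<open>Q\<^sub>n(x)\<close>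
  whenever \<open>I\<^sup>N\<close> kills \<open>x\<close> (\<open>torsion_stable\<close>).  They therefore act on the complex of torsion
  submodules and descend to its cohomology (\<open>local_cohomology_compatible\<close>).  What remains is that
  the Steenrod operators form a Hasse--Schmidt derivation of the ring of invariants, which holds because
  \<open>P(\<xi>)\<close> is multiplicative and commutes with the group action (\<open>hasse_schmidt_steenrod\<close>).
\<close>

section \<open>Hasse--Schmidt derivations and semilinear families\<close>

lemma (in abelian_monoid) finsum_triangle:
  assumes "\<And>i j :: nat. f i j \<in> carrier G"
  shows "(\<Oplus>k\<in>{0..n}. \<Oplus>i\<in>{0..k}. f i (k - i)) = (\<Oplus>i\<in>{0..n}. \<Oplus>j\<in>{0..n - i}. f i j)"
proof (induction n)
  case 0
  then show ?case using assms by simp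
next
  case (Suc n)
  have step: "(\<Oplus>j\<in>{..Suc n - i}. f i j) = f i (Suc n - i) \<oplus> (\<Oplus>j\<in>{..n - i}. f i j)" if "i \<in> {..n}" for i
    using that assms by (simp add: Suc_diff_le)
  have "(\<Oplus>i\<in>{..n}. \<Oplus>j\<in>{..Suc n - i}. f i j)
      = (\<Oplus>i\<in>{..n}. f i (Suc n - i) \<oplus> (\<Oplus>j\<in>{..n - i}. f i j))"
    by (rule finsum_cong') (use assms step in auto)
  also have "\<dots> = (\<Oplus>i\<in>{..n}. f i (Suc n - i)) \<oplus> (\<Oplus>i\<in>{..n}. \<Oplus>j\<in>{..n - i}. f i j)"
    by (rule finsum_addf) (use assms in auto)
  finally show ?case
    using Suc assms by (simp add: a_assoc flip: atMost_atLeast0)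
qed

text \<open>
  The conditions say that \<open>s \<mapsto> \<Sum> D\<^sub>i(s) \<xi>\<^sup>i\<close> is a ring homomorphism \<open>S \<rightarrow> S[[\<xi>]]\<close> lifting the identity.
\<close>

locale hasse_schmidt = cring S for S :: "'s ring" (structure) +
  fixes D :: "nat \<Rightarrow> 's \<Rightarrow> 's"
  assumes D_closed [simp, intro]: "s \<in> carrier S \<Longrightarrow> D n s \<in> carrier S"
    and D_add: "\<lbrakk>s \<in> carrier S; t \<in> carrier S\<rbrakk> \<Longrightarrow> D n (s \<oplus> t) = D n s \<oplus> D n t"
    and D_0: "s \<in> carrier S \<Longrightarrow> D 0 s = s"
    and D_mult: "\<lbrakk>s \<in> carrier S; t \<in> carrier S\<rbrakk> \<Longrightarrow>
      D n (s \<otimes> t) = (\<Oplus>i\<in>{0..n}. D i s \<otimes> D (n - i) t)"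
    and D_one: "n > 0 \<Longrightarrow> D n \<one> = \<zero>"
begin

text \<open>
  A sequence \<open>a\<close> stands for the power series \<open>\<Sum> a\<^sub>m \<xi>\<^sup>m\<close>; the value is the coefficient of \<open>\<xi>\<^sup>n\<close> in its
  product with \<open>\<Sum> D\<^sub>i(s) \<xi>\<^sup>i\<close>.
\<close>

definition twist :: "('s, 'm) module \<Rightarrow> 's \<Rightarrow> (nat \<Rightarrow> 'm) \<Rightarrow> nat \<Rightarrow> 'm" where
  "twist M s a n = (\<Oplus>\<^bsub>M\<^esub> i\<in>{0..n}. D i s \<odot>\<^bsub>M\<^esub> a (n - i))"

text \<open>
  For all \<open>n\<close> together this says that \<open>x \<mapsto> \<Sum> f\<^sub>n(x) \<xi>\<^sup>n\<close> is linear from \<open>X\<close> to the twisted module of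
  power series over \<open>M\<close>.  The condition is stated one coefficient at a time because families are built by
  recursion on \<open>n\<close>.
\<close>

definition twisted_linear :: "('s, 'm) module \<Rightarrow> 'm set \<Rightarrow> (nat \<Rightarrow> 'm \<Rightarrow> 'm) \<Rightarrow> nat \<Rightarrow> bool" where
  "twisted_linear M X f n \<longleftrightarrow>
     f n \<in> X \<rightarrow> carrier M \<and>
     (\<forall>x\<in>X. \<forall>y\<in>X. f n (x \<oplus>\<^bsub>M\<^esub> y) = f n x \<oplus>\<^bsub>M\<^esub> f n y) \<and>
     (\<forall>s\<in>carrier S. \<forall>x\<in>X. f n (s \<odot>\<^bsub>M\<^esub> x) = twist M s (\<lambda>m. f m x) n)"

definition compatible :: "('s, 'm) module \<Rightarrow> (nat \<Rightarrow> 'm \<Rightarrow> 'm) \<Rightarrow> bool" where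
  "compatible M Q \<longleftrightarrow> (\<forall>n. twisted_linear M (carrier M) Q n) \<and> (\<forall>x\<in>carrier M. Q 0 x = x)"

lemma twist_cong:
  assumes "Module.module S M" "s \<in> carrier S" "\<And>m. m \<le> n \<Longrightarrow> a m = b m" "\<And>m. m \<le> n \<Longrightarrow> b m \<in> carrier M"
  shows "twist M s a n = twist M s b n"
proof -
  interpret M: Module.module S M by fact
  show ?thesis unfolding twist_def by (rule M.finsum_cong') (use assms in auto)
qed

lemma twist_closed:
  assumes "Module.module S M" "s \<in> carrier S" "\<And>m. m \<le> n \<Longrightarrow> a m \<in> carrier M"
  shows "twist M s a n \<in> carrier M"
proof -
  interpret M: Module.module S M by fact
  show ?thesis unfolding twist_def by (rule M.finsum_closed) (use assms in auto)
qed

lemma twist_0: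
  assumes "Module.module S M" "s \<in> carrier S" "a 0 \<in> carrier M"
  shows "twist M s a 0 = s \<odot>\<^bsub>M\<^esub> a 0"
proof -
  interpret M: Module.module S M by fact
  show ?thesis using assms by (simp add: twist_def D_0)
qed

text \<open>
  Because \<open>D\<^sub>0\<close> is the identity, the top coefficient \<open>a\<^sub>n\<close> enters with the untwisted scalar \<open>s\<close>.
\<close>

lemma twist_leading_term:
  assumes "Module.module S M" "s \<in> carrier S" "\<And>m. m \<le> n \<Longrightarrow> a m \<in> carrier M"
  shows "twist M s a n = s \<odot>\<^bsub>M\<^esub> a n \<oplus>\<^bsub>M\<^esub> (\<Oplus>\<^bsub>M\<^esub> i\<in>{1..n}. D i s \<odot>\<^bsub>M\<^esub> a (n - i))"
proof -
  interpret M: Module.module S M by fact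
  have "{0..n} = insert 0 {1..n}" by auto
  then show ?thesis unfolding twist_def
    using assms by (simp add: D_0 M.finsum_insert Pi_iff)
qed

text \<open>
  Two series agreeing below degree \<open>n\<close> have twisted products whose difference in degree \<open>n\<close> is
  untwisted: the graded pieces of the \<open>\<xi>\<close>-adic filtration carry the ordinary module structure.
\<close>

lemma twist_change_last:
  assumes "Module.module S M" "s \<in> carrier S" "\<And>m. m < n \<Longrightarrow> a m = b m" "\<And>m. m < n \<Longrightarrow> b m \<in> carrier M"
    "a n = b n \<oplus>\<^bsub>M\<^esub> e" "b n \<in> carrier M" "e \<in> carrier M"
  shows "twist M s a n = twist M s b n \<oplus>\<^bsub>M\<^esub> s \<odot>\<^bsub>M\<^esub> e"
proof -
  interpret M: Module.module S M by fact
  have b: "b m \<in> carrier M" if "m \<le> n" for m using that assms by (cases "m = n") auto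
  have a: "a m \<in> carrier M" if "m \<le> n" for m using that assms by (cases "m = n") auto
  let ?r = "\<lambda>a. \<Oplus>\<^bsub>M\<^esub> i\<in>{1..n}. D i s \<odot>\<^bsub>M\<^esub> a (n - i)"
  have "?r a = ?r b" by (rule M.finsum_cong') (use assms in auto)
  moreover have "?r b \<in> carrier M" by (rule M.finsum_closed) (use assms b in auto)
  ultimately show ?thesis
    using twist_leading_term[OF assms(1,2) a] twist_leading_term[OF assms(1,2) b] assms
    by (simp add: M.smult_r_distr M.a_ac)
qed

lemma twist_add_right:
  assumes "Module.module S M" "s \<in> carrier S" "\<And>m. m \<le> n \<Longrightarrow> a m \<in> carrier M" "\<And>m. m \<le> n \<Longrightarrow> b m \<in> carrier M"
  shows "twist M s (\<lambda>m. a m \<oplus>\<^bsub>M\<^esub> b m) n = twist M s a n \<oplus>\<^bsub>M\<^esub> twist M s b n"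
proof -
  interpret M: Module.module S M by fact
  have "twist M s (\<lambda>m. a m \<oplus>\<^bsub>M\<^esub> b m) n
      = (\<Oplus>\<^bsub>M\<^esub> i\<in>{0..n}. D i s \<odot>\<^bsub>M\<^esub> a (n - i) \<oplus>\<^bsub>M\<^esub> D i s \<odot>\<^bsub>M\<^esub> b (n - i))"
    unfolding twist_def by (rule M.finsum_cong') (use assms in \<open>auto simp: M.smult_r_distr\<close>)
  also have "\<dots> = twist M s a n \<oplus>\<^bsub>M\<^esub> twist M s b n"
    unfolding twist_def by (rule M.finsum_addf) (use assms in auto)
  finally show ?thesis .
qed

lemma twist_add_left:
  assumes "Module.module S M" "s \<in> carrier S" "t \<in> carrier S" "\<And>m. m \<le> n \<Longrightarrow> a m \<in> carrier M"
  shows "twist M (s \<oplus> t) a n = twist M s a n \<oplus>\<^bsub>M\<^esub> twist M t a n"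
proof -
  interpret M: Module.module S M by fact
  have "twist M (s \<oplus> t) a n
      = (\<Oplus>\<^bsub>M\<^esub> i\<in>{0..n}. D i s \<odot>\<^bsub>M\<^esub> a (n - i) \<oplus>\<^bsub>M\<^esub> D i t \<odot>\<^bsub>M\<^esub> a (n - i))"
    unfolding twist_def by (rule M.finsum_cong') (use assms in \<open>auto simp: M.smult_l_distr D_add\<close>)
  also have "\<dots> = twist M s a n \<oplus>\<^bsub>M\<^esub> twist M t a n"
    unfolding twist_def by (rule M.finsum_addf) (use assms in auto)
  finally show ?thesis .
qed

lemma twist_one:
  assumes "Module.module S M" "\<And>m. m \<le> n \<Longrightarrow> a m \<in> carrier M"
  shows "twist M \<one> a n = a n"
proof -
  interpret M: Module.module S M by fact
  have "(\<Oplus>\<^bsub>M\<^esub> i\<in>{1..n}. D i \<one> \<odot>\<^bsub>M\<^esub> a (n - i)) = (\<Oplus>\<^bsub>M\<^esub> i\<in>{1..n}. \<zero>\<^bsub>M\<^esub>)"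
    by (rule M.finsum_cong') (use assms in \<open>auto simp: D_one\<close>)
  then show ?thesis using assms by (simp add: twist_leading_term[OF assms(1)])
qed

lemma finsum_smult_rdistr:
  assumes "Module.module S M" "finite A" "f \<in> A \<rightarrow> carrier S" "x \<in> carrier M"
  shows "(\<Oplus>i\<in>A. f i) \<odot>\<^bsub>M\<^esub> x = (\<Oplus>\<^bsub>M\<^esub> i\<in>A. f i \<odot>\<^bsub>M\<^esub> x)"
proof -
  interpret M: Module.module S M by fact
  show ?thesis using assms(2,3)
    by (induction A rule: finite_induct) (use assms(4) in \<open>auto simp: Pi_iff M.smult_l_distr\<close>)
qed

text \<open>
  Both sides are the sum of \<open>D\<^sub>i(s) D\<^sub>j(t) a\<^sub>k\<close> over \<open>i + j + k = n\<close>, grouped by \<open>i + j\<close> on the left and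
  by \<open>i\<close> on the right.
\<close>

lemma twist_assoc:
  assumes M: "Module.module S M" and st: "s \<in> carrier S" "t \<in> carrier S"
    and a: "\<And>m. a m \<in> carrier M"
  shows "twist M (s \<otimes> t) a n = twist M s (twist M t a) n"
proof -
  interpret M: Module.module S M by fact
  let ?f = "\<lambda>i j. (D i s \<otimes> D j t) \<odot>\<^bsub>M\<^esub> a (n - (i + j))"
  have f: "?f i j \<in> carrier M" for i j using st a by auto
  have "twist M (s \<otimes> t) a n = (\<Oplus>\<^bsub>M\<^esub> k\<in>{0..n}. \<Oplus>\<^bsub>M\<^esub> i\<in>{0..k}. ?f i (k - i))"
    unfolding twist_def
  proof (rule M.finsum_cong')
    fix k assume "k \<in> {0..n}"
    have "D k (s \<otimes> t) \<odot>\<^bsub>M\<^esub> a (n - k) = (\<Oplus>\<^bsub>M\<^esub> i\<in>{0..k}. (D i s \<otimes> D (k - i) t) \<odot>\<^bsub>M\<^esub> a (n - k))"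
      using st a by (simp add: D_mult finsum_smult_rdistr[OF M])
    also have "\<dots> = (\<Oplus>\<^bsub>M\<^esub> i\<in>{0..k}. ?f i (k - i))"
      by (rule M.finsum_cong') (use f st a in auto)
    finally show "D k (s \<otimes> t) \<odot>\<^bsub>M\<^esub> a (n - k) = (\<Oplus>\<^bsub>M\<^esub> i\<in>{0..k}. ?f i (k - i))" .
  qed (use f in \<open>auto intro!: M.finsum_closed\<close>)
  also have "\<dots> = (\<Oplus>\<^bsub>M\<^esub> i\<in>{0..n}. \<Oplus>\<^bsub>M\<^esub> j\<in>{0..n - i}. ?f i j)"
    by (rule M.finsum_triangle) (rule f)
  also have "\<dots> = twist M s (twist M t a) n"
    unfolding twist_def
  proof (rule M.finsum_cong')
    fix i assume i: "i \<in> {0..n}"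
    have "D i s \<odot>\<^bsub>M\<^esub> (\<Oplus>\<^bsub>M\<^esub> j\<in>{0..n - i}. D j t \<odot>\<^bsub>M\<^esub> a (n - i - j))
        = (\<Oplus>\<^bsub>M\<^esub> j\<in>{0..n - i}. D i s \<odot>\<^bsub>M\<^esub> (D j t \<odot>\<^bsub>M\<^esub> a (n - i - j)))"
      by (rule M.finsum_smult_ldistr) (use st a in auto)
    also have "\<dots> = (\<Oplus>\<^bsub>M\<^esub> j\<in>{0..n - i}. ?f i j)"
      by (rule M.finsum_cong') (use f st a in \<open>auto simp: M.smult_assoc1\<close>)
    finally show "(\<Oplus>\<^bsub>M\<^esub> j\<in>{0..n - i}. ?f i j)
        = D i s \<odot>\<^bsub>M\<^esub> (\<Oplus>\<^bsub>M\<^esub> j\<in>{0..n - i}. D j t \<odot>\<^bsub>M\<^esub> a (n - i - j))" by simp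
  qed (use st a in \<open>auto intro!: M.finsum_closed\<close>)
  finally show ?thesis .
qed

section \<open>Extending operators to an injective module\<close>

text \<open>
  Pairs of elements of a module are coded as lists so that the modules made of them have the carrier type
  over which \<open>injective_module\<close> quantifies its test modules.
\<close>

definition code_pair :: "'m \<Rightarrow> 'm \<Rightarrow> ('s + 'm) list" where
  "code_pair x e = [Inr x, Inr e]"

definition code_fst :: "('s + 'm) list \<Rightarrow> 'm" where "code_fst l = projr (l ! 0)"

definition code_snd :: "('s + 'm) list \<Rightarrow> 'm" where "code_snd l = projr (l ! 1)"

lemma code_pair_simps [simp]:
  "code_fst (code_pair x e) = x" "code_snd (code_pair x e) = e"
  "code_pair x e = code_pair x' e' \<longleftrightarrow> x = x' \<and> e = e'"
  by (auto simp: code_pair_def code_fst_def code_snd_def)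

text \<open>
  Given the coefficients \<open>f\<^sub>m\<close> for \<open>m < n\<close>, the pair \<open>(x, e)\<close> stands for \<open>x\<close> together with the truncated
  series \<open>f\<^sub>0(x) + f\<^sub>1(x) \<xi> + \<dots> + f\<^sub>n\<^sub>-\<^sub>1(x) \<xi>\<^sup>n\<^sup>-\<^sup>1 + e \<xi>\<^sup>n\<close>.  This is an extension of \<open>X\<close> by \<open>M\<close>, and its
  splittings correspond to the possible choices of \<open>f\<^sub>n\<close>.
\<close>

definition twisted_extension ::
    "('s, 'm) module \<Rightarrow> 'm set \<Rightarrow> (nat \<Rightarrow> 'm \<Rightarrow> 'm) \<Rightarrow> nat \<Rightarrow> ('s, ('s + 'm) list) module" where
  "twisted_extension M X f n =
     \<lparr>carrier = {code_pair x e |x e. x \<in> X \<and> e \<in> carrier M}, mult = undefined, one = undefined,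
      zero = code_pair \<zero>\<^bsub>M\<^esub> \<zero>\<^bsub>M\<^esub>,
      add = (\<lambda>k l. code_pair (code_fst k \<oplus>\<^bsub>M\<^esub> code_fst l) (code_snd k \<oplus>\<^bsub>M\<^esub> code_snd l)),
      smult = (\<lambda>s l. code_pair (s \<odot>\<^bsub>M\<^esub> code_fst l)
        (twist M s (\<lambda>m. if m < n then f m (code_fst l) else code_snd l) n))\<rparr>"

lemma twisted_extension_simps [simp]:
  "code_pair x e \<in> carrier (twisted_extension M X f n) \<longleftrightarrow> x \<in> X \<and> e \<in> carrier M"
  "\<zero>\<^bsub>twisted_extension M X f n\<^esub> = code_pair \<zero>\<^bsub>M\<^esub> \<zero>\<^bsub>M\<^esub>"
  "code_pair x e \<oplus>\<^bsub>twisted_extension M X f n\<^esub> code_pair x' e' = code_pair (x \<oplus>\<^bsub>M\<^esub> x') (e \<oplus>\<^bsub>M\<^esub> e')"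
  "s \<odot>\<^bsub>twisted_extension M X f n\<^esub> code_pair x e
     = code_pair (s \<odot>\<^bsub>M\<^esub> x) (twist M s (\<lambda>m. if m < n then f m x else e) n)"
  by (auto simp: twisted_extension_def cong: if_cong)

lemma twisted_extension_carrierE:
  assumes "l \<in> carrier (twisted_extension M X f n)"
  obtains x e where "l = code_pair x e" "x \<in> X" "e \<in> carrier M"
  using assms by (auto simp: twisted_extension_def)

text \<open>
  Semilinearity of \<open>f\<^sub>m\<close> for \<open>m < n\<close> is what makes the series of a multiple \<open>s (x, e)\<close> equal to the twisted
  product of \<open>s\<close> with the series of \<open>(x, e)\<close>; the module laws then follow from those of \<open>twist\<close>.
\<close>

lemma twisted_extension_module:
  assumes M: "Module.module S M" and X: "submodule X S M"
    and f: "\<And>m. m < n \<Longrightarrow> twisted_linear M X f m"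
  shows "Module.module S (twisted_extension M X f n)" (is "Module.module S ?Y")
proof -
  interpret M: Module.module S M by fact
  note XE = M.submoduleE[OF X]
  have X0: "\<zero>\<^bsub>M\<^esub> \<in> X" using subgroup.one_closed[OF submodule.axioms(1)[OF X]] by simp
  have Xc: "x \<in> carrier M" if "x \<in> X" for x using XE(1) that by auto
  have fc: "f m x \<in> carrier M" if "m < n" "x \<in> X" for m x
    using f[OF that(1)] that(2) by (auto simp: twisted_linear_def)
  have fadd: "f m (x \<oplus>\<^bsub>M\<^esub> y) = f m x \<oplus>\<^bsub>M\<^esub> f m y" if "m < n" "x \<in> X" "y \<in> X" for m x y
    using f[OF that(1)] that(2,3) by (auto simp: twisted_linear_def)
  have fsm: "f m (s \<odot>\<^bsub>M\<^esub> x) = twist M s (\<lambda>k. f k x) m" if "m < n" "x \<in> X" "s \<in> carrier S" for m x s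
    using f[OF that(1)] that(2,3) by (auto simp: twisted_linear_def)
  define u where "u = (\<lambda>x e m. if m < n then f m x else e)"
  have uc: "u x e m \<in> carrier M" if "x \<in> X" "e \<in> carrier M" for x e m
    using that by (auto simp: u_def fc)
  have sm: "s \<odot>\<^bsub>?Y\<^esub> code_pair x e = code_pair (s \<odot>\<^bsub>M\<^esub> x) (twist M s (u x e) n)" for s x e
    by (simp add: u_def)
  note tc = twist_closed[OF M _ uc]
  have ag: "abelian_group ?Y"
  proof (rule abelian_groupI, goal_cases)
    case (6 l)
    then obtain x e where l: "l = code_pair x e" "x \<in> X" "e \<in> carrier M"
      by (rule twisted_extension_carrierE)
    then show ?case
      by (intro bexI[of _ "code_pair (\<ominus>\<^bsub>M\<^esub> x) (\<ominus>\<^bsub>M\<^esub> e)"]) (auto simp: XE Xc M.l_neg)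
  qed (auto elim!: twisted_extension_carrierE simp: XE X0 Xc M.a_ac)
  show ?thesis
  proof (rule moduleI[OF is_cring ag], goal_cases)
    case (1 s l)
    then obtain x e where l: "l = code_pair x e" "x \<in> X" "e \<in> carrier M"
      by (auto elim: twisted_extension_carrierE)
    with 1 show ?case by (simp only: l(1) sm) (simp add: XE tc)
  next
    case (2 s t l)
    then obtain x e where l: "l = code_pair x e" "x \<in> X" "e \<in> carrier M"
      by (auto elim: twisted_extension_carrierE)
    with 2 show ?case
      by (simp only: l(1) sm) (simp add: M.smult_l_distr Xc twist_add_left[OF M] uc)
  next
    case (3 s k l)
    then obtain x e where k: "k = code_pair x e" "x \<in> X" "e \<in> carrier M"
      by (auto elim: twisted_extension_carrierE)
    from 3 obtain y e' where l: "l = code_pair y e'" "y \<in> X" "e' \<in> carrier M"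
      by (auto elim: twisted_extension_carrierE)
    have "u (x \<oplus>\<^bsub>M\<^esub> y) (e \<oplus>\<^bsub>M\<^esub> e') = (\<lambda>m. u x e m \<oplus>\<^bsub>M\<^esub> u y e' m)"
      using k l by (auto simp: u_def fadd)
    then show ?case
      using 3 k l by (simp only: k(1) l(1) sm twisted_extension_simps(3))
        (simp add: M.smult_r_distr Xc twist_add_right[OF M] uc)
  next
    case (4 s t l)
    then obtain x e where l: "l = code_pair x e" "x \<in> X" "e \<in> carrier M"
      by (auto elim: twisted_extension_carrierE)
    have *: "u (t \<odot>\<^bsub>M\<^esub> x) (twist M t (u x e) n) m = twist M t (u x e) m" if "m \<le> n" for m
      using that l 4
      by (auto simp: u_def fsm fc intro!: twist_cong[OF M])
    have "twist M (s \<otimes> t) (u x e) n = twist M s (twist M t (u x e)) n"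
      using l 4 by (intro twist_assoc[OF M]) (auto simp: uc)
    also have "\<dots> = twist M s (u (t \<odot>\<^bsub>M\<^esub> x) (twist M t (u x e) n)) n"
      by (rule twist_cong[OF M, symmetric]) (use * l 4 in \<open>auto simp: tc\<close>)
    finally show ?case
      using 4 l by (simp only: l(1) sm) (simp add: Xc M.smult_assoc1)
  next
    case (5 l)
    then obtain x e where l: "l = code_pair x e" "x \<in> X" "e \<in> carrier M"
      by (auto elim: twisted_extension_carrierE)
    have "twist M \<one> (u x e) n = e"
      using l by (subst twist_one[OF M]) (auto simp: u_def fc)
    with l show ?case by (simp only: l(1) sm) (simp add: Xc)
  qed
qed

text \<open>
  The next coefficient \<open>g\<^sub>n\<close> on \<open>X\<close> makes \<open>(x, e) \<mapsto> e - g\<^sub>n(x)\<close> a linear retraction onto \<open>M\<close> of the twisted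
  extension of \<open>X\<close>.  As \<open>M\<close> is injective, this extends to a linear retraction \<open>h\<close> on the twisted extension
  of all of \<open>M\<close>, and \<open>r(x) = - h(x, 0)\<close> is the desired coefficient.
\<close>

lemma extend_one_step:
  fixes M :: "('s, 'm) module"
  assumes inj: "injective_module S M" and X: "submodule X S M"
    and f: "\<And>m. m < n \<Longrightarrow> twisted_linear M (carrier M) f m"
    and g: "\<And>m. m \<le> n \<Longrightarrow> twisted_linear M X g m"
    and fg: "\<And>m x. m < n \<Longrightarrow> x \<in> X \<Longrightarrow> f m x = g m x"
  shows "\<exists>r. twisted_linear M (carrier M) (f(n := r)) n \<and> (\<forall>x\<in>X. r x = g n x)"
proof -
  from inj have M: "Module.module S M" by (simp add: injective_module_def)
  interpret M: Module.module S M by fact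
  note XE = M.submoduleE[OF X]
  have X0: "\<zero>\<^bsub>M\<^esub> \<in> X" using subgroup.one_closed[OF submodule.axioms(1)[OF X]] by simp
  have Xc: "x \<in> carrier M" if "x \<in> X" for x using XE(1) that by auto
  have fc: "f m x \<in> carrier M" if "m < n" "x \<in> carrier M" for m x
    using f[OF that(1)] that(2) by (auto simp: twisted_linear_def)
  have gc: "g m x \<in> carrier M" if "m \<le> n" "x \<in> X" for m x
    using g[OF that(1)] that(2) by (auto simp: twisted_linear_def)
  have gadd: "g m (x \<oplus>\<^bsub>M\<^esub> y) = g m x \<oplus>\<^bsub>M\<^esub> g m y" if "m \<le> n" "x \<in> X" "y \<in> X" for m x y
    using g[OF that(1)] that(2,3) by (auto simp: twisted_linear_def)
  have gsm: "g m (s \<odot>\<^bsub>M\<^esub> x) = twist M s (\<lambda>k. g k x) m" if "m \<le> n" "x \<in> X" "s \<in> carrier S" for m x s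
    using g[OF that(1)] that(2,3) by (auto simp: twisted_linear_def)
  have g0: "g n \<zero>\<^bsub>M\<^esub> = \<zero>\<^bsub>M\<^esub>"
    using gadd[of n "\<zero>\<^bsub>M\<^esub>" "\<zero>\<^bsub>M\<^esub>"] gc[of n "\<zero>\<^bsub>M\<^esub>"] X0 by simp
  have cancel: "x \<oplus>\<^bsub>M\<^esub> y \<oplus>\<^bsub>M\<^esub> \<ominus>\<^bsub>M\<^esub> x = y" if "x \<in> carrier M" "y \<in> carrier M" for x y
    using that by (metis M.a_assoc M.a_comm M.a_inv_closed M.r_neg M.r_zero)
  let ?Y = "twisted_extension M (carrier M) f n"
  let ?X = "twisted_extension M X f n"
  have fX: "twisted_linear M X f m" if "m < n" for m
    using f[OF that] XE(1) by (auto simp: twisted_linear_def subset_iff Pi_iff)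
  have Y: "Module.module S ?Y"
    by (rule twisted_extension_module[OF M M.carrier_is_submodule f])
  have X': "Module.module S ?X"
    by (rule twisted_extension_module[OF M X fX])
  have incl: "(\<lambda>l. l) \<in> mod_hom S ?X ?Y"
    by (auto simp: mod_hom_def Xc elim!: twisted_extension_carrierE)
  define \<phi> where "\<phi> = (\<lambda>l :: ('s + 'm) list. code_snd l \<oplus>\<^bsub>M\<^esub> \<ominus>\<^bsub>M\<^esub> g n (code_fst l))"
  have \<phi>: "\<phi> \<in> mod_hom S ?X M"
    unfolding mod_hom_def
  proof (intro CollectI conjI ballI Pi_I)
    fix l assume "l \<in> carrier ?X"
    then show "\<phi> l \<in> carrier M"
      by (auto elim!: twisted_extension_carrierE simp: \<phi>_def gc)
  next
    fix k l assume "k \<in> carrier ?X" "l \<in> carrier ?X"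
    then show "\<phi> (k \<oplus>\<^bsub>?X\<^esub> l) = \<phi> k \<oplus>\<^bsub>M\<^esub> \<phi> l"
      by (auto elim!: twisted_extension_carrierE simp: \<phi>_def gc gadd M.minus_add M.a_ac)
  next
    fix s l assume s: "s \<in> carrier S" and "l \<in> carrier ?X"
    from this(2) obtain x e where l: "l = code_pair x e" "x \<in> X" "e \<in> carrier M"
      by (rule twisted_extension_carrierE)
    have "twist M s (\<lambda>m. if m < n then f m x else e) n
        = twist M s (\<lambda>k. g k x) n \<oplus>\<^bsub>M\<^esub> s \<odot>\<^bsub>M\<^esub> (e \<oplus>\<^bsub>M\<^esub> \<ominus>\<^bsub>M\<^esub> g n x)"
      by (rule twist_change_last[OF M])
        (use s l in \<open>auto simp: fg gc M.a_lcomm M.r_neg\<close>)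
    moreover have "twist M s (\<lambda>k. g k x) n \<in> carrier M"
      by (rule twist_closed[OF M s]) (use l gc in auto)
    ultimately show "\<phi> (s \<odot>\<^bsub>?X\<^esub> l) = s \<odot>\<^bsub>M\<^esub> \<phi> l"
      using s l cancel by (simp add: \<phi>_def gsm gc)
  qed
  have "\<exists>h\<in>mod_hom S ?Y M. \<forall>x\<in>carrier ?X. h ((\<lambda>l. l) x) = \<phi> x"
    using inj X' Y incl \<phi> unfolding injective_module_def by (metis inj_on_id2)
  then obtain h where h: "h \<in> mod_hom S ?Y M" and h\<phi>: "\<And>l. l \<in> carrier ?X \<Longrightarrow> h l = \<phi> l" by auto
  define r where "r = (\<lambda>x. \<ominus>\<^bsub>M\<^esub> h (code_pair x \<zero>\<^bsub>M\<^esub>))"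
  have hc: "h (code_pair x e) \<in> carrier M" if "x \<in> carrier M" "e \<in> carrier M" for x e
    using h that by (auto simp: mod_hom_def Pi_iff)
  have hadd: "h (code_pair (x \<oplus>\<^bsub>M\<^esub> y) (e \<oplus>\<^bsub>M\<^esub> e')) = h (code_pair x e) \<oplus>\<^bsub>M\<^esub> h (code_pair y e')"
    if "x \<in> carrier M" "e \<in> carrier M" "y \<in> carrier M" "e' \<in> carrier M" for x y e e'
  proof -
    have "h (code_pair x e \<oplus>\<^bsub>?Y\<^esub> code_pair y e') = h (code_pair x e) \<oplus>\<^bsub>M\<^esub> h (code_pair y e')"
      using h that unfolding mod_hom_def by (simp del: twisted_extension_simps(3))
    then show ?thesis by simp
  qed
  have rX: "r x = g n x" if "x \<in> X" for x
    using that X0 by (simp add: r_def h\<phi> \<phi>_def gc)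
  have "r (s \<odot>\<^bsub>M\<^esub> x) = twist M s (\<lambda>m. (f(n := r)) m x) n" if s: "s \<in> carrier S" and x: "x \<in> carrier M" for s x
  proof -
    \<comment> \<open>\<open>?c\<close> is the second component of \<open>s (x, 0)\<close>, and \<open>h (0, ?c) = ?c\<close> because \<open>h\<close> is a retraction.\<close>
    let ?c = "twist M s (\<lambda>m. if m < n then f m x else \<zero>\<^bsub>M\<^esub>) n"
    have rc: "r x \<in> carrier M" using x by (simp add: r_def hc)
    have c: "?c \<in> carrier M" by (rule twist_closed[OF M s]) (auto simp: fc x)
    have "s \<odot>\<^bsub>M\<^esub> h (code_pair x \<zero>\<^bsub>M\<^esub>) = h (s \<odot>\<^bsub>?Y\<^esub> code_pair x \<zero>\<^bsub>M\<^esub>)"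
      using h s x unfolding mod_hom_def by (simp del: twisted_extension_simps(4))
    also have "\<dots> = h (code_pair (s \<odot>\<^bsub>M\<^esub> x \<oplus>\<^bsub>M\<^esub> \<zero>\<^bsub>M\<^esub>) (\<zero>\<^bsub>M\<^esub> \<oplus>\<^bsub>M\<^esub> ?c))"
      using s x c by simp
    also have "\<dots> = h (code_pair (s \<odot>\<^bsub>M\<^esub> x) \<zero>\<^bsub>M\<^esub>) \<oplus>\<^bsub>M\<^esub> h (code_pair \<zero>\<^bsub>M\<^esub> ?c)"
      using s x c by (intro hadd) auto
    also have "h (code_pair \<zero>\<^bsub>M\<^esub> ?c) = ?c"
      using X0 c by (simp add: h\<phi> \<phi>_def g0)
    finally have eq: "s \<odot>\<^bsub>M\<^esub> h (code_pair x \<zero>\<^bsub>M\<^esub>) = h (code_pair (s \<odot>\<^bsub>M\<^esub> x) \<zero>\<^bsub>M\<^esub>) \<oplus>\<^bsub>M\<^esub> ?c" .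
    have "twist M s (\<lambda>m. (f(n := r)) m x) n = ?c \<oplus>\<^bsub>M\<^esub> s \<odot>\<^bsub>M\<^esub> r x"
      by (rule twist_change_last[OF M s]) (use rc x in \<open>auto simp: fc\<close>)
    also have "s \<odot>\<^bsub>M\<^esub> r x = \<ominus>\<^bsub>M\<^esub> (h (code_pair (s \<odot>\<^bsub>M\<^esub> x) \<zero>\<^bsub>M\<^esub>) \<oplus>\<^bsub>M\<^esub> ?c)"
      using s x by (simp add: r_def M.smult_r_minus hc eq)
    also have "?c \<oplus>\<^bsub>M\<^esub> \<dots> = r (s \<odot>\<^bsub>M\<^esub> x)"
      using s x c by (simp add: r_def M.minus_add hc M.a_lcomm M.r_neg)
    finally show ?thesis by simp
  qed
  moreover have "r (x \<oplus>\<^bsub>M\<^esub> y) = r x \<oplus>\<^bsub>M\<^esub> r y" if "x \<in> carrier M" "y \<in> carrier M" for x y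
    using hadd[of x "\<zero>\<^bsub>M\<^esub>" y "\<zero>\<^bsub>M\<^esub>"] that by (simp add: r_def hc M.minus_add)
  moreover have "r x \<in> carrier M" if "x \<in> carrier M" for x
    using that by (simp add: r_def hc)
  ultimately have "twisted_linear M (carrier M) (f(n := r)) n"
    by (simp add: twisted_linear_def)
  with rX show ?thesis by blast
qed

text \<open>
  The coefficient in degree 0 is fixed to be the identity; each further one is supplied by
  \<open>extend_one_step\<close>.
\<close>

lemma extend_compatible:
  fixes M :: "('s, 'm) module"
  assumes inj: "injective_module S M" and X: "submodule X S M"
    and g: "\<And>m. twisted_linear M X g m"
    and g0: "\<And>x. x \<in> X \<Longrightarrow> g 0 x = x"
  shows "\<exists>Q. compatible M Q \<and> (\<forall>n. \<forall>x\<in>X. Q n x = g n x)"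
proof -
  from inj have M: "Module.module S M" by (simp add: injective_module_def)
  interpret M: Module.module S M by fact
  have XE: "X \<subseteq> carrier M" by (rule M.submoduleE[OF X])
  have cong: "twisted_linear M (carrier M) f n = twisted_linear M (carrier M) f' n"
    if "\<And>m. m \<le> n \<Longrightarrow> f m = f' m" for f f' n
  proof -
    have "twist M s (\<lambda>m. f m x) n = twist M s (\<lambda>m. f' m x) n" for s x
      by (simp add: twist_def that)
    with that show ?thesis by (simp add: twisted_linear_def)
  qed
  let ?P = "\<lambda>f n r. twisted_linear M (carrier M) (f(n := r)) n \<and> (\<forall>x\<in>X. r x = g n x) \<and>
    (n = 0 \<longrightarrow> (\<forall>x\<in>carrier M. r x = x))"
  have "\<exists>Q. \<forall>n. ?P Q n (Q n)"
  proof (rule dependent_wellorder_choice)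
    fix r and f f' :: "nat \<Rightarrow> 'm \<Rightarrow> 'm" and n assume "\<And>m. m < n \<Longrightarrow> f m = f' m"
    then have "twisted_linear M (carrier M) (f(n := r)) n = twisted_linear M (carrier M) (f'(n := r)) n"
      by (intro cong) auto
    then show "?P f n r = ?P f' n r" by simp
  next
    fix n and f :: "nat \<Rightarrow> 'm \<Rightarrow> 'm" assume IH: "\<And>m. m < n \<Longrightarrow> ?P f m (f m)"
    show "\<exists>r. ?P f n r"
    proof (cases "n = 0")
      case True
      have "twisted_linear M (carrier M) (f(0 := \<lambda>x. x)) 0"
        by (simp add: twisted_linear_def twist_0[OF M])
      with True g0 show ?thesis by (intro exI[of _ "\<lambda>x. x"]) auto
    next
      case False
      then show ?thesis
        using extend_one_step[OF inj X, of n f g] IH g by auto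
    qed
  qed
  then obtain Q where Q: "\<And>n. ?P Q n (Q n)" by blast
  then have "compatible M Q" by (simp add: compatible_def)
  with Q show ?thesis by blast
qed

section \<open>Operators on an injective resolution\<close>

lemma mod_homD:
  assumes "f \<in> mod_hom S M N"
  shows "x \<in> carrier M \<Longrightarrow> f x \<in> carrier N"
    and "\<lbrakk>x \<in> carrier M; y \<in> carrier M\<rbrakk> \<Longrightarrow> f (x \<oplus>\<^bsub>M\<^esub> y) = f x \<oplus>\<^bsub>N\<^esub> f y"
    and "\<lbrakk>s \<in> carrier S; x \<in> carrier M\<rbrakk> \<Longrightarrow> f (s \<odot>\<^bsub>M\<^esub> x) = s \<odot>\<^bsub>N\<^esub> f x"
  using assms by (auto simp: mod_hom_def)

lemma mod_hom_zero:
  assumes M: "Module.module S M" and N: "Module.module S N" and f: "f \<in> mod_hom S M N"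
  shows "f \<zero>\<^bsub>M\<^esub> = \<zero>\<^bsub>N\<^esub>"
proof -
  interpret M: Module.module S M by fact
  interpret N: Module.module S N by fact
  show ?thesis
    using mod_homD(3)[OF f, of \<zero> "\<zero>\<^bsub>M\<^esub>"] mod_homD(1)[OF f, of "\<zero>\<^bsub>M\<^esub>"] by simp
qed

lemma mod_hom_finsum:
  assumes M: "Module.module S M" and N: "Module.module S N" and f: "f \<in> mod_hom S M N"
    and "finite A" "h \<in> A \<rightarrow> carrier M"
  shows "f (\<Oplus>\<^bsub>M\<^esub> i\<in>A. h i) = (\<Oplus>\<^bsub>N\<^esub> i\<in>A. f (h i))"
proof -
  interpret M: Module.module S M by fact
  interpret N: Module.module S N by fact
  show ?thesis
    using assms(4,5)
    by (induction A rule: finite_induct)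
      (auto simp: mod_hom_zero[OF M N f] mod_homD[OF f] Pi_iff M.finsum_closed)
qed

lemma mod_hom_twist:
  assumes M: "Module.module S M" and N: "Module.module S N" and f: "f \<in> mod_hom S M N"
    and s: "s \<in> carrier S" and a: "\<And>m. m \<le> n \<Longrightarrow> a m \<in> carrier M"
  shows "f (twist M s a n) = twist N s (\<lambda>m. f (a m)) n"
proof -
  interpret M: Module.module S M by fact
  interpret N: Module.module S N by fact
  have "f (twist M s a n) = (\<Oplus>\<^bsub>N\<^esub> i\<in>{0..n}. f (D i s \<odot>\<^bsub>M\<^esub> a (n - i)))"
    unfolding twist_def by (rule mod_hom_finsum[OF M N f]) (use s a in auto)
  also have "\<dots> = twist N s (\<lambda>m. f (a m)) n"
    unfolding twist_def by (rule N.finsum_cong') (use s a in \<open>auto simp: mod_homD[OF f]\<close>)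
  finally show ?thesis .
qed

lemma compatibleD:
  assumes "compatible M Q"
  shows "x \<in> carrier M \<Longrightarrow> Q n x \<in> carrier M"
    and "\<lbrakk>x \<in> carrier M; y \<in> carrier M\<rbrakk> \<Longrightarrow> Q n (x \<oplus>\<^bsub>M\<^esub> y) = Q n x \<oplus>\<^bsub>M\<^esub> Q n y"
    and "\<lbrakk>s \<in> carrier S; x \<in> carrier M\<rbrakk> \<Longrightarrow> Q n (s \<odot>\<^bsub>M\<^esub> x) = twist M s (\<lambda>m. Q m x) n"
    and "x \<in> carrier M \<Longrightarrow> Q 0 x = x"
  using assms by (auto simp: compatible_def twisted_linear_def)

lemma compatible_zero:
  assumes M: "Module.module S M" and Q: "compatible M Q"
  shows "Q n \<zero>\<^bsub>M\<^esub> = \<zero>\<^bsub>M\<^esub>"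
proof -
  interpret M: Module.module S M by fact
  show ?thesis
    using compatibleD(1)[OF Q, of "\<zero>\<^bsub>M\<^esub>" n] compatibleD(2)[OF Q, of "\<zero>\<^bsub>M\<^esub>" "\<zero>\<^bsub>M\<^esub>" n] by simp
qed

text \<open>
  Closure under negation follows from scalar multiplication by \<open>-1\<close>.
\<close>

lemma submodule_criterion:
  assumes M: "Module.module S M" and H: "H \<subseteq> carrier M" "\<zero>\<^bsub>M\<^esub> \<in> H"
    and add: "\<And>x y. x \<in> H \<Longrightarrow> y \<in> H \<Longrightarrow> x \<oplus>\<^bsub>M\<^esub> y \<in> H"
    and smult: "\<And>s x. s \<in> carrier S \<Longrightarrow> x \<in> H \<Longrightarrow> s \<odot>\<^bsub>M\<^esub> x \<in> H"
  shows "submodule H S M"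
proof -
  interpret M: Module.module S M by fact
  have "\<ominus>\<^bsub>M\<^esub> x \<in> H" if "x \<in> H" for x
  proof -
    have "\<ominus>\<^bsub>M\<^esub> x = (\<ominus> \<one>) \<odot>\<^bsub>M\<^esub> x" using that H by (subst M.smult_l_minus) auto
    then show ?thesis using smult that by simp
  qed
  then show ?thesis using assms by (intro M.submoduleI) auto
qed

lemma image_submodule:
  assumes M: "Module.module S M" and N: "Module.module S N" and f: "f \<in> mod_hom S M N"
  shows "submodule (f ` carrier M) S N"
proof -
  interpret M: Module.module S M by fact
  interpret N: Module.module S N by fact
  show ?thesis
  proof (rule submodule_criterion[OF N])
    show "\<zero>\<^bsub>N\<^esub> \<in> f ` carrier M" using mod_hom_zero[OF M N f] by (metis M.zero_closed image_eqI)
  qed (auto simp: mod_homD[OF f] simp flip: mod_homD(2,3)[OF f])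
qed

text \<open>
  If \<open>f x = f y\<close>, then \<open>P n\<close> maps \<open>x - y\<close> into the kernel of \<open>f\<close>; so \<open>f (P n x)\<close> depends only on \<open>f x\<close>,
  and any choice of preimages yields the operators on the image.
\<close>

lemma compatible_descends_to_image:
  assumes M: "Module.module S M" and N: "Module.module S N" and f: "f \<in> mod_hom S M N"
    and P: "compatible M P"
    and ker: "\<And>n x. \<lbrakk>x \<in> carrier M; f x = \<zero>\<^bsub>N\<^esub>\<rbrakk> \<Longrightarrow> f (P n x) = \<zero>\<^bsub>N\<^esub>"
  obtains g where "\<And>n. twisted_linear N (f ` carrier M) g n"
    and "\<And>n x. x \<in> carrier M \<Longrightarrow> g n (f x) = f (P n x)"
proof -
  interpret M: Module.module S M by fact
  interpret N: Module.module S N by fact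
  have wd: "f (P n x) = f (P n y)" if "x \<in> carrier M" "y \<in> carrier M" "f x = f y" for n x y
  proof -
    let ?z = "x \<oplus>\<^bsub>M\<^esub> \<ominus>\<^bsub>M\<^esub> y"
    have z: "?z \<in> carrier M" "y \<oplus>\<^bsub>M\<^esub> ?z = x" using that by (auto simp: M.a_lcomm M.r_neg)
    have "f x \<oplus>\<^bsub>N\<^esub> f ?z = f x \<oplus>\<^bsub>N\<^esub> \<zero>\<^bsub>N\<^esub>"
      using z that mod_homD(1,2)[OF f] by (metis N.r_zero)
    then have "f ?z = \<zero>\<^bsub>N\<^esub>"
      using z that mod_homD(1)[OF f] by (metis N.r_neg1 N.zero_closed)
    then have "f (P n ?z) = \<zero>\<^bsub>N\<^esub>" using ker z by blast
    moreover have "f (P n x) = f (P n y) \<oplus>\<^bsub>N\<^esub> f (P n ?z)"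
      using z that compatibleD(1,2)[OF P] mod_homD(2)[OF f] by metis
    ultimately show ?thesis
      using that compatibleD(1)[OF P] mod_homD(1)[OF f] by simp
  qed
  define g where "g = (\<lambda>n y. f (P n (inv_into (carrier M) f y)))"
  have gf: "g n (f x) = f (P n x)" if "x \<in> carrier M" for n x
    unfolding g_def using that by (intro wd) (auto simp: inv_into_into f_inv_into_f)
  have "twisted_linear N (f ` carrier M) g n" for n
    unfolding twisted_linear_def
  proof (intro conjI ballI Pi_I)
    fix y assume "y \<in> f ` carrier M"
    then show "g n y \<in> carrier N" by (auto simp: gf compatibleD[OF P] mod_homD[OF f])
  next
    fix y z assume "y \<in> f ` carrier M" "z \<in> f ` carrier M"
    then show "g n (y \<oplus>\<^bsub>N\<^esub> z) = g n y \<oplus>\<^bsub>N\<^esub> g n z"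
      by (auto simp: gf compatibleD(1,2)[OF P] mod_homD(2)[OF f] simp flip: mod_homD(2)[OF f])
  next
    fix s y assume s: "s \<in> carrier S" and "y \<in> f ` carrier M"
    then obtain x where x: "x \<in> carrier M" "y = f x" by auto
    have "g n (s \<odot>\<^bsub>N\<^esub> y) = f (twist M s (\<lambda>m. P m x) n)"
      using s x by (simp add: gf compatibleD(3)[OF P] flip: mod_homD(3)[OF f])
    also have "\<dots> = twist N s (\<lambda>m. g m y) n"
      using s x by (subst mod_hom_twist[OF M N f]) (auto simp: gf compatibleD(1)[OF P])
    finally show "g n (s \<odot>\<^bsub>N\<^esub> y) = twist N s (\<lambda>m. g m y) n" .
  qed
  with gf show ?thesis using that by blast
qed

lemma compatible_surjective_image:
  assumes M: "Module.module S M" and N: "Module.module S N" and f: "f \<in> mod_hom S M N"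
    and surj: "f ` carrier M = carrier N"
    and P: "compatible M P"
    and ker: "\<And>n x. \<lbrakk>x \<in> carrier M; f x = \<zero>\<^bsub>N\<^esub>\<rbrakk> \<Longrightarrow> f (P n x) = \<zero>\<^bsub>N\<^esub>"
  shows "\<exists>Q. compatible N Q"
proof -
  obtain g where g: "\<And>n. twisted_linear N (f ` carrier M) g n"
    "\<And>n x. x \<in> carrier M \<Longrightarrow> g n (f x) = f (P n x)"
    using compatible_descends_to_image[OF M N f P ker] by blast
  have "g 0 y = y" if "y \<in> carrier N" for y
    using that g(2) compatibleD(4)[OF P] by (auto simp flip: surj)
  with g(1) have "compatible N g" by (simp add: compatible_def surj)
  then show ?thesis by blast
qed

lemma compatible_into_injective:
  assumes M: "Module.module S M" and N: "injective_module S N" and f: "f \<in> mod_hom S M N"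
    and P: "compatible M P"
    and ker: "\<And>n x. \<lbrakk>x \<in> carrier M; f x = \<zero>\<^bsub>N\<^esub>\<rbrakk> \<Longrightarrow> f (P n x) = \<zero>\<^bsub>N\<^esub>"
  shows "\<exists>Q. compatible N Q \<and> (\<forall>n. \<forall>x\<in>carrier M. Q n (f x) = f (P n x))"
proof -
  have N': "Module.module S N" using N by (simp add: injective_module_def)
  obtain g where g: "\<And>n. twisted_linear N (f ` carrier M) g n"
    "\<And>n x. x \<in> carrier M \<Longrightarrow> g n (f x) = f (P n x)"
    using compatible_descends_to_image[OF M N' f P ker] by blast
  have "g 0 y = y" if "y \<in> f ` carrier M" for y
    using that g(2) compatibleD(4)[OF P] by auto
  then show ?thesis
    using extend_compatible[OF N image_submodule[OF M N' f] g(1)] g(2) by fastforce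
qed

text \<open>
  The construction goes up the resolution.  Operators on \<open>E j\<close> preserve the kernel of \<open>d j\<close>, since this is
  the image of the preceding map and they commute with that map; so they descend to the image of \<open>d j\<close> in
  \<open>E (Suc j)\<close> and extend from there.
\<close>

lemma compatible_resolution:
  assumes res: "injective_resolution S M E \<epsilon> d" and P: "compatible M P"
  obtains Q where "\<And>j. compatible (E j) (Q j)"
    and "\<And>j n x. x \<in> carrier (E j) \<Longrightarrow> Q (Suc j) n (d j x) = d j (Q j n x)"
proof -
  have M: "Module.module S M" and inj: "\<And>j. injective_module S (E j)"
    and \<epsilon>: "\<epsilon> \<in> mod_hom S M (E 0)" "inj_on \<epsilon> (carrier M)"
    and d: "\<And>j. d j \<in> mod_hom S (E j) (E (Suc j))"
    and ex0: "\<epsilon> ` carrier M = mod_ker (E 0) (E 1) (d 0)"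
    and ex: "\<And>j. d j ` carrier (E j) = mod_ker (E (Suc j)) (E (Suc (Suc j))) (d (Suc j))"
    using res by (auto simp: injective_resolution_def)
  have E: "Module.module S (E j)" for j using inj[of j] by (simp add: injective_module_def)
  interpret M: Module.module S M by fact
  \<comment> \<open>Stability of the kernel is carried along, as it is what allows the next step.\<close>
  let ?P = "\<lambda>j Q. compatible (E j) Q \<and>
    (\<forall>n. \<forall>x\<in>mod_ker (E j) (E (Suc j)) (d j). d j (Q n x) = \<zero>\<^bsub>E (Suc j)\<^esub>)"
  let ?R = "\<lambda>j Q Q'. \<forall>n. \<forall>x\<in>carrier (E j). Q' n (d j x) = d j (Q n x)"
  have "\<exists>Q. \<forall>j. ?P j (Q j) \<and> ?R j (Q j) (Q (Suc j))"
  proof (rule dependent_nat_choice)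
    have "\<epsilon> (P n x) = \<zero>\<^bsub>E 0\<^esub>" if "x \<in> carrier M" "\<epsilon> x = \<zero>\<^bsub>E 0\<^esub>" for n x
    proof -
      have "x = \<zero>\<^bsub>M\<^esub>"
        using that \<epsilon>(2) mod_hom_zero[OF M E \<epsilon>(1)] by (metis M.zero_closed inj_onD)
      then show ?thesis by (simp add: compatible_zero[OF M P] mod_hom_zero[OF M E \<epsilon>(1)])
    qed
    then obtain Q where Q: "compatible (E 0) Q" "\<And>n x. x \<in> carrier M \<Longrightarrow> Q n (\<epsilon> x) = \<epsilon> (P n x)"
      using compatible_into_injective[OF M inj \<epsilon>(1) P] by blast
    have "d 0 (Q n y) = \<zero>\<^bsub>E (Suc 0)\<^esub>" if "y \<in> mod_ker (E 0) (E (Suc 0)) (d 0)" for n y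
    proof -
      from that ex0 obtain x where x: "x \<in> carrier M" "y = \<epsilon> x" by auto
      then have "Q n y \<in> \<epsilon> ` carrier M" using Q(2) compatibleD(1)[OF P] by auto
      then show ?thesis unfolding ex0 by (simp add: mod_ker_def)
    qed
    with Q show "\<exists>Q. ?P 0 Q" by blast
  next
    fix Q j assume Q: "?P j Q"
    then obtain Q' where Q': "compatible (E (Suc j)) Q'"
      "\<And>n x. x \<in> carrier (E j) \<Longrightarrow> Q' n (d j x) = d j (Q n x)"
      using compatible_into_injective[OF E inj d, of j Q] by (auto simp: mod_ker_def)
    have "d (Suc j) (Q' n y) = \<zero>\<^bsub>E (Suc (Suc j))\<^esub>"
      if "y \<in> mod_ker (E (Suc j)) (E (Suc (Suc j))) (d (Suc j))" for n y
    proof -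
      from that ex[of j] obtain x where x: "x \<in> carrier (E j)" "y = d j x" by auto
      then have "Q' n y \<in> d j ` carrier (E j)" using Q'(2) Q by (auto simp: compatibleD(1))
      then show ?thesis unfolding ex by (simp add: mod_ker_def)
    qed
    with Q' show "\<exists>Q'. ?P (Suc j) Q' \<and> ?R j Q Q'" by blast
  qed
  then show ?thesis using that by blast
qed

section \<open>Torsion is preserved\<close>

definition ideal_power :: "'s set \<Rightarrow> nat \<Rightarrow> 's set" where
  "ideal_power I n = I [^]\<^bsub>ideals_set S\<^esub> n"

lemma ideal_power_0: "ideal_power I 0 = carrier S"
  and ideal_power_Suc: "ideal_power I (Suc n) = ideal_prod S (ideal_power I n) I"
  by (simp_all add: ideal_power_def nat_pow_def ideals_set_def)

context
  fixes I assumes I: "ideal I S"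
begin

lemma ideal_power_is_ideal: "ideal (ideal_power I n) S"
  by (induction n) (simp_all add: ideal_power_0 ideal_power_Suc oneideal ideal_prod_is_ideal I)

lemma ideal_power_antimono: "m \<le> n \<Longrightarrow> ideal_power I n \<subseteq> ideal_power I m"
  by (rule lift_Suc_antimono_le[of "ideal_power I"])
    (use ideal_prod_inter[OF ideal_power_is_ideal I] in \<open>auto simp: ideal_power_Suc\<close>)

lemma ideal_finsum_closed:
  assumes J: "ideal J S" and "finite A" "\<And>i. i \<in> A \<Longrightarrow> f i \<in> J"
  shows "(\<Oplus>i\<in>A. f i) \<in> J"
proof -
  interpret J: ideal J S by fact
  show ?thesis using assms(2,3)
    by (induction A rule: finite_induct) (auto simp: Pi_iff)
qed

text \<open>
  In the Leibniz expansion of \<open>D\<^sub>i\<close> on a product of \<open>m\<close> elements of \<open>I\<close>, at most \<open>i\<close> factors are hit by an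
  operator of positive index, and the others stay in \<open>I\<close>.
\<close>

lemma D_ideal_power: "a \<in> ideal_power I m \<Longrightarrow> D i a \<in> ideal_power I (m - i)"
proof (induction m arbitrary: a i)
  case 0
  then show ?case by (simp add: ideal_power_0)
next
  case (Suc m)
  interpret J: ideal "ideal_power I (Suc m - i)" S by (rule ideal_power_is_ideal)
  have carr: "x \<in> carrier S" if "x \<in> ideal_power I k" for x k using ideal.Icarr[OF ideal_power_is_ideal that] .
  from Suc.prems have "a \<in> ideal_prod S (ideal_power I m) I" by (simp add: ideal_power_Suc)
  then have "a \<in> carrier S \<and> D i a \<in> ideal_power I (Suc m - i)"
  proof induction
    case (prod x y)
    have xy: "x \<in> carrier S" "y \<in> carrier S" using prod carr ideal.Icarr[OF I] by auto
    have "D k x \<otimes> D (i - k) y \<in> ideal_power I (Suc m - i)" if k: "k \<in> {0..i}" for k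
    \<comment> \<open>For \<open>k = i\<close> the factor \<open>y\<close> is not differentiated and raises the power by one.  For \<open>k < i\<close> already
      \<open>D k x\<close> lies in the power of exponent \<open>m - k \<ge> Suc m - i\<close>.\<close>
    proof (cases "k = i")
      case True
      have "D i x \<otimes> y \<in> ideal_power I (Suc (m - i))"
        using Suc.IH[OF prod(1)] prod(2) by (auto simp: ideal_power_Suc intro: ideal_prod.prod)
      moreover have "ideal_power I (Suc (m - i)) \<subseteq> ideal_power I (Suc m - i)" by (rule ideal_power_antimono) auto
      ultimately show ?thesis using True xy by (auto simp: D_0)
    next
      case False
      then have "ideal_power I (m - k) \<subseteq> ideal_power I (Suc m - i)" using k by (intro ideal_power_antimono) auto
      then show ?thesis using Suc.IH[OF prod(1), of k] xy by (intro J.I_r_closed) auto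
    qed
    then have "D i (x \<otimes> y) \<in> ideal_power I (Suc m - i)"
      unfolding D_mult[OF xy] by (intro ideal_finsum_closed[OF ideal_power_is_ideal]) auto
    with xy show ?case by simp
  next
    case (sum x y)
    then show ?case by (simp add: D_add)
  qed
  then show ?case by blast
qed

text \<open>
  For \<open>a\<close> in \<open>I\<^sup>N\<^sup>+\<^sup>n\<close> one has \<open>0 = Q\<^sub>n(a x) = a Q\<^sub>n(x) + \<Sum> D\<^sub>i(a) Q\<^sub>n\<^sub>-\<^sub>i(x)\<close> with \<open>i \<ge> 1\<close>, where \<open>D\<^sub>i(a)\<close> lies in
  \<open>I\<^sup>N\<^sup>+\<^sup>n\<^sup>-\<^sup>i\<close> and hence kills \<open>Q\<^sub>n\<^sub>-\<^sub>i(x)\<close> by induction.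
\<close>

lemma torsion_stable:
  assumes M: "Module.module S M" and Q: "compatible M Q"
    and x: "x \<in> carrier M" and tors: "\<And>a. a \<in> ideal_power I N \<Longrightarrow> a \<odot>\<^bsub>M\<^esub> x = \<zero>\<^bsub>M\<^esub>"
  shows "a \<in> ideal_power I (N + n) \<Longrightarrow> a \<odot>\<^bsub>M\<^esub> Q n x = \<zero>\<^bsub>M\<^esub>"
proof (induction n arbitrary: a rule: less_induct)
  case (less n)
  interpret M: Module.module S M by fact
  have a: "a \<in> carrier S" using ideal.Icarr[OF ideal_power_is_ideal less.prems] .
  have "D i a \<odot>\<^bsub>M\<^esub> Q (n - i) x = \<zero>\<^bsub>M\<^esub>" if "i \<in> {1..n}" for i
  proof (rule less.IH)
    show "D i a \<in> ideal_power I (N + (n - i))" using D_ideal_power[OF less.prems, of i] that by simp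
  qed (use that in auto)
  then have "(\<Oplus>\<^bsub>M\<^esub> i\<in>{1..n}. D i a \<odot>\<^bsub>M\<^esub> Q (n - i) x) = (\<Oplus>\<^bsub>M\<^esub> i\<in>{1..n}. \<zero>\<^bsub>M\<^esub>)"
    by (intro M.finsum_cong') auto
  then have "twist M a (\<lambda>m. Q m x) n = a \<odot>\<^bsub>M\<^esub> Q n x"
    using a x by (simp add: twist_leading_term[OF M] compatibleD(1)[OF Q])
  moreover have "a \<odot>\<^bsub>M\<^esub> x = \<zero>\<^bsub>M\<^esub>" using tors less.prems ideal_power_antimono[of N "N + n"] by auto
  ultimately show ?case
    using compatibleD(3)[OF Q a x, of n] compatible_zero[OF M Q] by simp
qed

end

section \<open>Passage to local cohomology\<close>

lemma submodule_module:
  assumes "Module.module S M" "submodule H S M"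
  shows "Module.module S (M\<lparr>carrier := H\<rparr>)"
  using submodule.submodule_is_module[OF assms(2,1)] .

lemma twist_submodule:
  assumes M: "Module.module S M" and H: "submodule H S M"
    and s: "s \<in> carrier S" and a: "\<And>m. a m \<in> H"
  shows "twist (M\<lparr>carrier := H\<rparr>) s a n = twist M s a n"
proof -
  interpret M: Module.module S M by fact
  interpret H: Module.module S "M\<lparr>carrier := H\<rparr>" by (rule submodule_module[OF M H])
  have "(\<lambda>x. x) \<in> mod_hom S (M\<lparr>carrier := H\<rparr>) M"
    using M.submoduleE(1)[OF H] by (auto simp: mod_hom_def)
  from mod_hom_twist[OF H.module_axioms M this s, of n a] a show ?thesis by simp
qed

lemma compatible_submodule:
  assumes M: "Module.module S M" and H: "submodule H S M" and Q: "compatible M Q"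
    and stable: "\<And>n x. x \<in> H \<Longrightarrow> Q n x \<in> H"
  shows "compatible (M\<lparr>carrier := H\<rparr>) Q"
proof -
  interpret M: Module.module S M by fact
  have "x \<in> carrier M" if "x \<in> H" for x using M.submoduleE(1)[OF H] that by auto
  then show ?thesis
    by (auto simp: compatible_def twisted_linear_def compatibleD[OF Q] stable twist_submodule[OF M H])
qed

lemma module_surjective_image:
  assumes M: "Module.module S M" and f: "f \<in> mod_hom S M N" and surj: "f ` carrier M = carrier N"
    and zero: "f \<zero>\<^bsub>M\<^esub> = \<zero>\<^bsub>N\<^esub>"
  shows "Module.module S N"
proof -
  interpret M: Module.module S M by fact
  have N: "\<exists>x\<in>carrier M. y = f x" if "y \<in> carrier N" for y using that surj by auto
  have fadd: "f x \<oplus>\<^bsub>N\<^esub> f y = f (x \<oplus>\<^bsub>M\<^esub> y)" if "x \<in> carrier M" "y \<in> carrier M" for x y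
    using that mod_homD(2)[OF f] by simp
  have fsm: "s \<odot>\<^bsub>N\<^esub> f x = f (s \<odot>\<^bsub>M\<^esub> x)" if "s \<in> carrier S" "x \<in> carrier M" for s x
    using that mod_homD(3)[OF f] by simp
  note fc = mod_homD(1)[OF f]
  have "abelian_group N"
  proof (rule abelian_groupI, goal_cases)
    case (6 y)
    then obtain x where x: "x \<in> carrier M" "y = f x" using N by blast
    then show ?case
      by (intro bexI[of _ "f (\<ominus>\<^bsub>M\<^esub> x)"]) (auto simp: fadd fc M.l_neg zero)
  qed (auto dest!: N simp: fadd fc M.a_ac simp flip: zero)
  then show ?thesis
    by (intro moduleI[OF is_cring])
      (auto dest!: N simp: fadd fsm fc M.smult_l_distr M.smult_r_distr M.smult_assoc1)
qed

text \<open>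
  The scalar product of \<open>s\<close> with a coset is a union over all its elements; each of them contributes the same
  coset, because \<open>H\<close> is closed under multiplication by \<open>s\<close>.
\<close>

lemma quotient_projection:
  assumes M: "Module.module S M" and H: "submodule H S M"
  shows "(\<lambda>x. H +>\<^bsub>M\<^esub> x) \<in> mod_hom S M (quotient_module M H)"
    and "(\<lambda>x. H +>\<^bsub>M\<^esub> x) ` carrier M = carrier (quotient_module M H)"
    and "x \<in> carrier M \<Longrightarrow> H +>\<^bsub>M\<^esub> x = \<zero>\<^bsub>quotient_module M H\<^esub> \<longleftrightarrow> x \<in> H"
proof -
  interpret M: Module.module S M by fact
  interpret H: abelian_subgroup H M
    by (rule abelian_subgroupI3) (use H M.abelian_group_axioms in
      \<open>auto simp: additive_subgroup_def submodule_def\<close>)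
  show surj: "(\<lambda>x. H +>\<^bsub>M\<^esub> x) ` carrier M = carrier (quotient_module M H)"
    by (auto simp: quotient_module_def A_RCOSETS_def' a_r_coset_def')
  show ker: "H +>\<^bsub>M\<^esub> x = \<zero>\<^bsub>quotient_module M H\<^esub> \<longleftrightarrow> x \<in> H" if "x \<in> carrier M" for x
    using that H.a_rcos_self[of x] H.a_rcos_const[of x] by (auto simp: quotient_module_def)
  have sm: "(\<Union>z\<in>H +>\<^bsub>M\<^esub> x. H +>\<^bsub>M\<^esub> (s \<odot>\<^bsub>M\<^esub> z)) = H +>\<^bsub>M\<^esub> (s \<odot>\<^bsub>M\<^esub> x)"
    if s: "s \<in> carrier S" and x: "x \<in> carrier M" for s x
  proof -
    have "H +>\<^bsub>M\<^esub> (s \<odot>\<^bsub>M\<^esub> z) = H +>\<^bsub>M\<^esub> (s \<odot>\<^bsub>M\<^esub> x)" if z: "z \<in> H +>\<^bsub>M\<^esub> x" for z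
    proof -
      from z obtain h where h: "h \<in> H" "z = h \<oplus>\<^bsub>M\<^esub> x" by (auto simp: a_r_coset_def')
      then have "s \<odot>\<^bsub>M\<^esub> z = s \<odot>\<^bsub>M\<^esub> h \<oplus>\<^bsub>M\<^esub> s \<odot>\<^bsub>M\<^esub> x"
        using s x by (simp add: M.smult_r_distr)
      moreover have "s \<odot>\<^bsub>M\<^esub> h \<in> H" using M.submoduleE(4)[OF H s] h by blast
      ultimately have "s \<odot>\<^bsub>M\<^esub> z \<in> H +>\<^bsub>M\<^esub> (s \<odot>\<^bsub>M\<^esub> x)"
        by (auto simp: a_r_coset_def')
      then show ?thesis
        using M.a_repr_independence'[OF _ _ H.a_subgroup, folded a_r_coset_def] s x by simp
    qed
    moreover have "x \<in> H +>\<^bsub>M\<^esub> x" using x by (rule H.a_rcos_self)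
    ultimately show ?thesis by blast
  qed
  show "(\<lambda>x. H +>\<^bsub>M\<^esub> x) \<in> mod_hom S M (quotient_module M H)"
    unfolding mod_hom_def
    using surj by (auto simp: quotient_module_def H.a_rcos_sum sm)
qed

lemma compatible_quotient:
  assumes M: "Module.module S M" and H: "submodule H S M" and Q: "compatible M Q"
    and stable: "\<And>n x. x \<in> H \<Longrightarrow> Q n x \<in> H"
  shows "Module.module S (quotient_module M H) \<and> (\<exists>Q'. compatible (quotient_module M H) Q')"
proof -
  interpret M: Module.module S M by fact
  note p = quotient_projection[OF M H]
  have H0: "\<zero>\<^bsub>M\<^esub> \<in> H" using subgroup.one_closed[OF submodule.axioms(1)[OF H]] by simp
  have N: "Module.module S (quotient_module M H)"
    by (rule module_surjective_image[OF M p(1,2)]) (simp add: p(3) H0)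
  moreover have "\<exists>Q'. compatible (quotient_module M H) Q'"
    by (rule compatible_surjective_image[OF M N p(1,2) Q])
      (simp add: p(3) compatibleD(1)[OF Q] stable)
  ultimately show ?thesis ..
qed

text \<open>
  The operators on the resolution preserve torsion and commute with the differentials, so they preserve the
  torsion cocycles \<open>K\<close> and the torsion coboundaries \<open>B\<close> and act on the quotient.
\<close>

theorem local_cohomology_compatible:
  assumes I: "ideal I S" and res: "injective_resolution S M E \<epsilon> d" and P: "compatible M P"
  shows "Module.module S (local_cohomology S I E d i)
    \<and> (\<exists>Q. compatible (local_cohomology S I E d i) Q)"
proof -
  have d: "\<And>j. d j \<in> mod_hom S (E j) (E (Suc j))"
    and ex: "\<And>j. d j ` carrier (E j) = mod_ker (E (Suc j)) (E (Suc (Suc j))) (d (Suc j))"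
    and E: "\<And>j. Module.module S (E j)"
    using res by (auto simp: injective_resolution_def injective_module_def)
  have dd: "d (Suc j) (d j x) = \<zero>\<^bsub>E (Suc (Suc j))\<^esub>" if "x \<in> carrier (E j)" for j x
    using ex[of j] that by (auto simp: mod_ker_def)
  have d0: "d j \<zero>\<^bsub>E j\<^esub> = \<zero>\<^bsub>E (Suc j)\<^esub>" for j by (rule mod_hom_zero[OF E E d])
  obtain Q where Q: "\<And>j. compatible (E j) (Q j)"
    and Qd: "\<And>j n x. x \<in> carrier (E j) \<Longrightarrow> Q (Suc j) n (d j x) = d j (Q j n x)"
    using compatible_resolution[OF res P] by blast
  define T where "T = (\<lambda>j. {x \<in> carrier (E j). \<exists>N. \<forall>a\<in>ideal_power I N. a \<odot>\<^bsub>E j\<^esub> x = \<zero>\<^bsub>E j\<^esub>})"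
  have TE: "torsion_submodule S I (E j) = (E j)\<lparr>carrier := T j\<rparr>" for j
    by (simp add: torsion_submodule_def T_def ideal_power_def)
  have ic: "a \<in> carrier S" if "a \<in> ideal_power I n" for a n
    using ideal.Icarr[OF ideal_power_is_ideal[OF I] that] .
  have T0: "\<zero>\<^bsub>E j\<^esub> \<in> T j" for j
  proof -
    interpret Ej: Module.module S "E j" by (rule E)
    show ?thesis by (auto simp: T_def ic)
  qed
  have Tadd: "x \<oplus>\<^bsub>E j\<^esub> y \<in> T j" if xy: "x \<in> T j" "y \<in> T j" for j x y
  proof -
    interpret Ej: Module.module S "E j" by (rule E)
    obtain m n where "\<forall>a\<in>ideal_power I m. a \<odot>\<^bsub>E j\<^esub> x = \<zero>\<^bsub>E j\<^esub>" "\<forall>a\<in>ideal_power I n. a \<odot>\<^bsub>E j\<^esub> y = \<zero>\<^bsub>E j\<^esub>"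
      using xy by (auto simp: T_def)
    then have "\<forall>a\<in>ideal_power I (max m n). a \<odot>\<^bsub>E j\<^esub> (x \<oplus>\<^bsub>E j\<^esub> y) = \<zero>\<^bsub>E j\<^esub>"
      using xy ideal_power_antimono[OF I, of m "max m n"] ideal_power_antimono[OF I, of n "max m n"]
      by (auto simp: T_def Ej.smult_r_distr ic subset_iff)
    then show ?thesis using xy by (auto simp: T_def)
  qed
  have Tsm: "s \<odot>\<^bsub>E j\<^esub> x \<in> T j" if s: "s \<in> carrier S" and x: "x \<in> T j" for j s x
  proof -
    interpret Ej: Module.module S "E j" by (rule E)
    obtain m where m: "\<forall>a\<in>ideal_power I m. a \<odot>\<^bsub>E j\<^esub> x = \<zero>\<^bsub>E j\<^esub>" using x by (auto simp: T_def)
    have "a \<odot>\<^bsub>E j\<^esub> (s \<odot>\<^bsub>E j\<^esub> x) = \<zero>\<^bsub>E j\<^esub>" if a: "a \<in> ideal_power I m" for a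
    proof -
      have "a \<otimes> s \<in> ideal_power I m" using ideal.I_r_closed[OF ideal_power_is_ideal[OF I]] a s by blast
      then show ?thesis using m ic[OF a] s x by (auto simp: T_def simp flip: Ej.smult_assoc1)
    qed
    then show ?thesis using s x by (auto simp: T_def)
  qed
  have dT: "d j x \<in> T (Suc j)" if "x \<in> T j" for j x
    using that ic by (fastforce simp: T_def mod_homD[OF d] d0 simp flip: mod_homD(3)[OF d])
  have QT: "Q j n x \<in> T j" if "x \<in> T j" for j n x
    using that torsion_stable[OF I E Q, of x j] compatibleD(1)[OF Q] unfolding T_def by blast
  define K where "K = {x \<in> T i. d i x = \<zero>\<^bsub>E (Suc i)\<^esub>}"
  define B where "B = coboundaries (\<lambda>n. torsion_submodule S I (E n)) d i"
  have H: "local_cohomology S I E d i = quotient_module ((E i)\<lparr>carrier := K\<rparr>) B"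
    by (simp add: local_cohomology_def cohomology_def B_def TE mod_ker_def K_def)
  have Tc: "x \<in> carrier (E j)" if "x \<in> T j" for j x using that by (simp add: T_def)
  interpret E': Module.module S "E (Suc i)" by (rule E)
  have K: "submodule K S (E i)"
    by (rule submodule_criterion[OF E])
      (auto simp: K_def Tc T0 Tadd Tsm d0 mod_homD[OF d])
  have QK: "Q i n x \<in> K" if "x \<in> K" for n x
    using that Qd[of x i n] by (auto simp: K_def QT Tc compatible_zero[OF E Q])
  have MK: "Module.module S ((E i)\<lparr>carrier := K\<rparr>)" by (rule submodule_module[OF E K])
  have B: "submodule B S ((E i)\<lparr>carrier := K\<rparr>) \<and> (\<forall>n. \<forall>x\<in>B. Q i n x \<in> B)"
  proof (cases i)
    case 0
    interpret E0: Module.module S "E i" by (rule E)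
    have "B = {\<zero>\<^bsub>E i\<^esub>}" using 0 by (simp add: B_def coboundaries_def TE)
    then show ?thesis
      by (intro conjI submodule_criterion[OF MK])
        (auto simp: K_def T0 d0 compatible_zero[OF E Q])
  next
    case (Suc j)
    have B: "B = d j ` T j" using Suc by (simp add: B_def coboundaries_def TE)
    have "submodule B S ((E i)\<lparr>carrier := K\<rparr>)"
    proof (rule submodule_criterion[OF MK])
      show "B \<subseteq> carrier ((E i)\<lparr>carrier := K\<rparr>)"
        using Suc by (auto simp: B K_def dT dd Tc)
      show "\<zero>\<^bsub>(E i)\<lparr>carrier := K\<rparr>\<^esub> \<in> B"
        using Suc T0[of j] d0[of j] by (auto simp: B intro: rev_image_eqI)
    qed (use Suc in \<open>auto simp: B Tadd Tsm Tc simp flip: mod_homD(2,3)[OF d]\<close>)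
    moreover have "Q i n x \<in> B" if "x \<in> B" for n x
      using that Suc by (auto simp: B Qd Tc QT)
    ultimately show ?thesis by blast
  qed
  show ?thesis
    unfolding H
    by (rule compatible_quotient[OF MK _ compatible_submodule[OF E K Q QK]]) (use B in auto)
qed

lemma ring_as_module_compatible:
  shows "Module.module S (ring_as_module S)" and "compatible (ring_as_module S) D"
proof -
  have add_group: "abelian_group (ring_as_module S)"
    by (rule abelian_groupI)
      (auto simp: ring_as_module_def a_ac intro: bexI[of _ "\<ominus> x" for x] l_neg)
  show "Module.module S (ring_as_module S)"
    by (rule moduleI[OF is_cring add_group])
      (auto simp: ring_as_module_def l_distr r_distr m_assoc)
  have "finsum (ring_as_module S) f A = finsum S f A" for f :: "nat \<Rightarrow> 's" and A
    by (simp add: finsum_def finprod_def ring_as_module_def)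
  then show "compatible (ring_as_module S) D"
    by (auto simp: compatible_def twisted_linear_def twist_def D_add D_0 D_mult)
      (auto simp: ring_as_module_def D_add D_0 D_mult)
qed

end

section \<open>Steenrod operators on the ring of invariants\<close>

lemma sym_ring_induct [consumes 1, case_names const var add mult]:
  fixes f :: "('v, 'k::comm_ring_1) mpoly"
  assumes f: "f \<in> carrier (sym_ring B)"
    and const: "\<And>c. P (mp_const c)"
    and var: "\<And>b. b \<in> B \<Longrightarrow> P (mp_var b)"
    and add: "\<And>f g. P f \<Longrightarrow> P g \<Longrightarrow> P (f + g)"
    and mult: "\<And>f g. P f \<Longrightarrow> P g \<Longrightarrow> P (f * g)"
  shows "P f"
proof -
  have one: "P 1" using const[of 1] by (simp add: mp_const_1)
  have var_power: "P (Poly_Mapping.single (Poly_Mapping.single b k) 1)" if "b \<in> B" for b k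
  proof (induction k)
    case 0
    then show ?case using one by simp
  next
    case (Suc k)
    have "Poly_Mapping.single (Poly_Mapping.single b (Suc k)) 1
        = (mp_var b * Poly_Mapping.single (Poly_Mapping.single b k) 1 :: ('v, 'k) mpoly)"
      by (simp add: mp_var_def mult_single flip: single_add)
    then show ?case using mult[OF var[OF that] Suc] by simp
  qed
  have monom: "P (Poly_Mapping.single (\<Sum>b\<in>A. Poly_Mapping.single b (k b)) 1)"
    if "finite A" "A \<subseteq> B" for A and k :: "'v \<Rightarrow> nat"
    using that
  proof (induction A rule: finite_induct)
    case empty
    then show ?case using one by simp
  next
    case (insert b A)
    have "Poly_Mapping.single (\<Sum>b\<in>insert b A. Poly_Mapping.single b (k b)) 1
        = (Poly_Mapping.single (Poly_Mapping.single b (k b)) 1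
           * Poly_Mapping.single (\<Sum>b\<in>A. Poly_Mapping.single b (k b)) 1 :: ('v, 'k) mpoly)"
      using insert by (simp add: mult_single)
    then show ?case using insert mult var_power by simp
  qed
  have monomial: "P (Poly_Mapping.single m c)" if "Poly_Mapping.keys m \<subseteq> B" for m :: "'v \<Rightarrow>\<^sub>0 nat" and c
  proof -
    have "Poly_Mapping.single m c = mp_const c * Poly_Mapping.single m 1"
      by (simp add: mp_const_def mult_single)
    also have "Poly_Mapping.single m (1 :: 'k) = Poly_Mapping.single
        (\<Sum>b\<in>Poly_Mapping.keys m. Poly_Mapping.single b (Poly_Mapping.lookup m b)) 1"
      by (simp flip: mp_expand)
    finally show ?thesis using mult[OF const monom] that by simp
  qed
  have "P (\<Sum>m\<in>A. Poly_Mapping.single m (Poly_Mapping.lookup f m))"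
    if "finite A" "A \<subseteq> Poly_Mapping.keys f" for A
    using that
  proof (induction A rule: finite_induct)
    case empty
    then show ?case using const[of 0] by (simp add: mp_const_0)
  next
    case (insert m A)
    then show ?case using add monomial f by (simp add: sym_ring_def)
  qed
  from this[OF finite_keys order_refl] show ?thesis by (simp only: mp_expand[of f, symmetric])
qed

lemma sym_ring_closed:
  fixes f g :: "('v, 'k::comm_ring_1) mpoly"
  shows "mp_const c \<in> carrier (sym_ring B)"
    and "b \<in> B \<Longrightarrow> mp_var b \<in> carrier (sym_ring B)"
    and "\<lbrakk>f \<in> carrier (sym_ring B); g \<in> carrier (sym_ring B)\<rbrakk> \<Longrightarrow> f + g \<in> carrier (sym_ring B)"
    and "\<lbrakk>f \<in> carrier (sym_ring B); g \<in> carrier (sym_ring B)\<rbrakk> \<Longrightarrow> f * g \<in> carrier (sym_ring B)"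
proof -
  show "mp_const c \<in> carrier (sym_ring B)" by (simp add: sym_ring_def mp_const_def)
  show "b \<in> B \<Longrightarrow> mp_var b \<in> carrier (sym_ring B)" by (simp add: sym_ring_def mp_var_def)
  assume fg: "f \<in> carrier (sym_ring B)" "g \<in> carrier (sym_ring B)"
  then show "f + g \<in> carrier (sym_ring B)" using keys_add[of f g] by (auto simp: sym_ring_def)
  have "Poly_Mapping.keys m \<subseteq> B" if m: "m \<in> Poly_Mapping.keys (f * g)" for m
  proof -
    from m keys_mult[of f g] obtain k l
      where "m = k + l" "k \<in> Poly_Mapping.keys f" "l \<in> Poly_Mapping.keys g" by auto
    with fg keys_add[of k l] show ?thesis by (simp add: sym_ring_def) blast
  qed
  then show "f * g \<in> carrier (sym_ring B)" by (simp add: sym_ring_def)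
qed

lemma sym_ring_sum_closed:
  fixes h :: "'a \<Rightarrow> ('v, 'k::comm_ring_1) mpoly"
  shows "(\<And>i. i \<in> A \<Longrightarrow> h i \<in> carrier (sym_ring B)) \<Longrightarrow> sum h A \<in> carrier (sym_ring B)"
proof (induction A rule: infinite_finite_induct)
  case (insert x F)
  then show ?case by (simp add: sym_ring_closed)
qed (use sym_ring_closed(1)[of 0] in \<open>simp_all add: mp_const_0\<close>)

lemma steenrod_add: "steenrod n (f + g) = steenrod n f + steenrod n g"
  by (simp add: steenrod_def steenrod_total_add)

lemma steenrod_mult: "steenrod n (f * g) = (\<Sum>i\<in>{0..n}. steenrod i f * steenrod (n - i) g)"
  by (simp add: steenrod_def steenrod_total_mult coeff_mult atMost_atLeast0)

lemma steenrod_const: "steenrod n (mp_const c) = (if n = 0 then mp_const c else 0)"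
  by (cases n) (simp_all add: steenrod_def steenrod_total_const)

lemma steenrod_var:
  "steenrod n (mp_var b :: ('v, 'k::finite_field) mpoly)
     = (if n = 0 then mp_var b else if n = 1 then mp_var b ^ CARD('k) else 0)"
  by (auto simp: steenrod_def steenrod_total_def mp_subst_var mp_const_0 mp_const_1 coeff_pCons split: nat.split)

lemma steenrod_lin_form:
  "steenrod n (lin_form B l :: ('v, 'k::finite_field) mpoly)
     = (if n = 0 then lin_form B l else if n = 1 then lin_form B l ^ CARD('k) else 0)"
  by (auto simp: steenrod_def steenrod_total_lin_form coeff_pCons split: nat.split)

lemma mpoly_in_sym_ring_UNIV: "f \<in> carrier (sym_ring UNIV)"
  by (simp add: sym_ring_def)

lemma steenrod_0: "steenrod 0 f = f"
  using mpoly_in_sym_ring_UNIV[of f]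
  by (induction rule: sym_ring_induct) (simp_all add: steenrod_const steenrod_var steenrod_add steenrod_mult)

lemma steenrod_sym_ring:
  fixes f :: "('v, 'k::finite_field) mpoly"
  assumes "f \<in> carrier (sym_ring B)"
  shows "steenrod n f \<in> carrier (sym_ring B)"
proof -
  have power: "g ^ k \<in> carrier (sym_ring B)" if "g \<in> carrier (sym_ring B)"
    for g :: "('v, 'k) mpoly" and k
  proof -
    have "1 \<in> carrier (sym_ring B :: ('v, 'k) mpoly ring)"
      using sym_ring_closed(1)[of 1] by (simp add: mp_const_1)
    then show ?thesis by (induction k) (simp_all add: sym_ring_closed that)
  qed
  have zero: "0 \<in> carrier (sym_ring B :: ('v, 'k) mpoly ring)"
    using sym_ring_closed(1)[of 0] by (simp add: mp_const_0)
  have "\<forall>n. steenrod n f \<in> carrier (sym_ring B)"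
    using assms
  proof (induction rule: sym_ring_induct)
    case (mult f g)
    then show ?case by (auto simp: steenrod_mult sym_ring_closed intro!: sym_ring_sum_closed)
  qed (simp_all add: steenrod_const steenrod_var steenrod_add sym_ring_closed power zero)
  then show ?thesis by blast
qed

lemma sym_act_add: "sym_act scale B g (f + h) = sym_act scale B g f + sym_act scale B g h"
  and sym_act_mult: "sym_act scale B g (f * h) = sym_act scale B g f * sym_act scale B g h"
  and sym_act_const: "sym_act scale B g (mp_const c) = mp_const c"
  and sym_act_var: "sym_act scale B g (mp_var b)
    = lin_form B (\<lambda>v. Modules.module.representation scale B (inv_into UNIV g v) b)"
  by (simp_all add: sym_act_def mp_subst_add mp_subst_mult mp_subst_const mp_subst_var
      mp_const_add mp_const_mult mp_const_0 mp_const_1)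

lemma sym_act_sum: "sym_act scale B g (sum h A) = (\<Sum>i\<in>A. sym_act scale B g (h i))"
  unfolding sym_act_def by (rule mp_subst_sum) (rule mp_const_add)

lemma sym_act_power: "sym_act scale B g (f ^ n) = sym_act scale B g f ^ n"
  using sym_act_const[of scale B g 1] by (induction n) (simp_all add: sym_act_mult mp_const_1)

text \<open>
  Both sides are additive in \<open>f\<close> and obey the same Leibniz rule, so it suffices to compare them on constants
  and variables.  The action sends a variable to a linear form, and \<open>P(\<xi>)\<close> has the same shape \<open>l + l\<^sup>q \<xi>\<close> on
  every linear form \<open>l\<close>.
\<close>

lemma sym_act_steenrod:
  fixes f :: "('v::ab_group_add, 'k::finite_field) mpoly"
  shows "sym_act scale B g (steenrod n f) = steenrod n (sym_act scale B g f)"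
proof -
  have "\<forall>n. sym_act scale B g (steenrod n f) = steenrod n (sym_act scale B g f)"
    using mpoly_in_sym_ring_UNIV[of f]
  proof (induction rule: sym_ring_induct)
    case (const c)
    then show ?case
      using sym_act_const[of scale B g 0] by (simp add: steenrod_const sym_act_const mp_const_0)
  next
    case (var b)
    then show ?case
      using sym_act_const[of scale B g 0]
      by (simp add: steenrod_var steenrod_lin_form sym_act_var sym_act_power mp_const_0)
  qed (simp_all add: steenrod_add steenrod_mult sym_act_add sym_act_mult sym_act_sum)
  then show ?thesis by blast
qed

lemma invariant_ring_carrier:
  "carrier (invariant_ring scale B G)
    = {f \<in> carrier (sym_ring B). \<forall>g\<in>G. sym_act scale B g f = f}"
  by (simp add: invariant_ring_def)

lemma invariant_ring_simps:
  "mult (invariant_ring scale B G) = (*)" "one (invariant_ring scale B G) = 1"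
  "zero (invariant_ring scale B G) = 0" "add (invariant_ring scale B G) = (+)"
  by (simp_all add: invariant_ring_def sym_ring_def)

lemma invariant_ring_closed:
  fixes f h :: "('v::ab_group_add, 'k::field) mpoly"
  shows "mp_const c \<in> carrier (invariant_ring scale B G)"
    and "\<lbrakk>f \<in> carrier (invariant_ring scale B G); h \<in> carrier (invariant_ring scale B G)\<rbrakk>
      \<Longrightarrow> f + h \<in> carrier (invariant_ring scale B G)"
    and "\<lbrakk>f \<in> carrier (invariant_ring scale B G); h \<in> carrier (invariant_ring scale B G)\<rbrakk>
      \<Longrightarrow> f * h \<in> carrier (invariant_ring scale B G)"
  by (auto simp: invariant_ring_carrier sym_ring_closed sym_act_add sym_act_mult sym_act_const)

lemma cring_invariant_ring:
  fixes scale :: "'k::field \<Rightarrow> 'v::ab_group_add \<Rightarrow> 'v"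
  shows "cring (invariant_ring scale B G)" (is "cring ?S")
proof (rule cringI)
  have const: "0 \<in> carrier ?S" "1 \<in> carrier ?S"
    using invariant_ring_closed(1)[of 0] invariant_ring_closed(1)[of 1]
    by (simp_all add: mp_const_0 mp_const_1)
  have neg: "- f \<in> carrier ?S" if "f \<in> carrier ?S" for f
  proof -
    have "mp_const (-1) + mp_const 1 = (mp_const 0 :: ('v, 'k) mpoly)"
      by (simp flip: mp_const_add)
    then have "mp_const (-1) = (-1 :: ('v, 'k) mpoly)"
      by (simp add: mp_const_0 mp_const_1 eq_neg_iff_add_eq_0)
    then show ?thesis using invariant_ring_closed(3)[OF invariant_ring_closed(1)[of "-1"] that] by simp
  qed
  show "abelian_group ?S"
  proof (rule abelian_groupI, goal_cases)
    case (6 f)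
    then show ?case by (intro bexI[of _ "- f"]) (simp_all add: invariant_ring_simps neg)
  qed (simp_all add: invariant_ring_simps invariant_ring_closed const add_ac)
  show "comm_monoid ?S"
    by (rule comm_monoidI) (simp_all add: invariant_ring_simps invariant_ring_closed const mult_ac)
qed (simp add: invariant_ring_simps distrib_right)

lemma hasse_schmidt_steenrod:
  fixes scale :: "'k::finite_field \<Rightarrow> 'v::ab_group_add \<Rightarrow> 'v"
  shows "hasse_schmidt (invariant_ring scale B G) steenrod" (is "hasse_schmidt ?S _")
proof -
  interpret S: cring ?S by (rule cring_invariant_ring)
  have finsum: "finsum ?S h A = sum h A" if "finite A" "\<And>i. i \<in> A \<Longrightarrow> h i \<in> carrier ?S"
    for h and A :: "nat set"
    using that by (induction A rule: finite_induct) (auto simp: Pi_iff invariant_ring_simps)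
  have closed: "steenrod n f \<in> carrier ?S" if "f \<in> carrier ?S" for n f
    using that by (simp add: invariant_ring_carrier steenrod_sym_ring sym_act_steenrod)
  show ?thesis
  proof
    fix f h n assume "f \<in> carrier ?S" "h \<in> carrier ?S"
    then show "steenrod n (f \<otimes>\<^bsub>?S\<^esub> h)
        = (\<Oplus>\<^bsub>?S\<^esub> i\<in>{0..n}. steenrod i f \<otimes>\<^bsub>?S\<^esub> steenrod (n - i) h)"
      by (subst finsum) (simp_all add: invariant_ring_simps steenrod_mult closed invariant_ring_closed)
  next
    fix n :: nat assume "n > 0"
    then show "steenrod n \<one>\<^bsub>?S\<^esub> = \<zero>\<^bsub>?S\<^esub>"
      using steenrod_const[of n 1] by (simp add: invariant_ring_simps mp_const_1)
  qed (simp_all add: closed invariant_ring_simps steenrod_add steenrod_0)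
qed

theorem theorem1p17:
  fixes scale :: "'k::finite_field \<Rightarrow> 'v::ab_group_add \<Rightarrow> 'v"
    and B :: "'v set"
    and G :: "('v \<Rightarrow> 'v) set"
    and S :: "('v, 'k) mpoly ring"
    and I :: "('v, 'k) mpoly set"
    and xs :: "('v, 'k) mpoly list"
    and E :: "nat \<Rightarrow> (('v, 'k) mpoly, 'e) module"
    and \<epsilon> :: "('v, 'k) mpoly \<Rightarrow> 'e"
    and d :: "nat \<Rightarrow> 'e \<Rightarrow> 'e"
    and i :: nat
  assumes "finite_dimensional_vector_space scale B"
    and "subgroup G (general_linear_group scale)"
    and "S = invariant_ring scale B G"
    and "homogeneous_ideal I S"
    and "set xs \<subseteq> carrier S"
    and "\<forall>x\<in>set xs. homogeneous x"
    and "I = Idl\<^bsub>S\<^esub> (set xs)"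
    and "injective_resolution S (ring_as_module S) E \<epsilon> d"
  shows "\<exists>Q. cartan_module S (local_cohomology S I E d i) Q"
proof -
  interpret hasse_schmidt S steenrod
    using hasse_schmidt_steenrod[of scale B G] assms(3) by simp
  let ?H = "local_cohomology S I E d i"
  have "ideal I S" using assms(4) by (simp add: homogeneous_ideal_def)
  then obtain Q where H: "Module.module S ?H" and Q: "compatible ?H Q"
    using local_cohomology_compatible[OF _ assms(8) ring_as_module_compatible(2)] by blast
  interpret H: Module.module S ?H by (rule H)
  have const: "mp_const c \<in> carrier S" for c
    unfolding assms(3) by (rule invariant_ring_closed(1))
  \<comment> \<open>Linearity over the field is the Cartan formula for a constant, on which only \<open>steenrod 0\<close> is nonzero.\<close>
  have "Q n (mp_const c \<odot>\<^bsub>?H\<^esub> x) = mp_const c \<odot>\<^bsub>?H\<^esub> Q n x" if "x \<in> carrier ?H" for n c x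
  proof -
    have "(\<Oplus>\<^bsub>?H\<^esub> i\<in>{1..n}. steenrod i (mp_const c) \<odot>\<^bsub>?H\<^esub> Q (n - i) x)
        = (\<Oplus>\<^bsub>?H\<^esub> i\<in>{1..n}. \<zero>\<^bsub>?H\<^esub>)"
    proof (rule H.finsum_cong')
      fix i assume "i \<in> {1..n}"
      then have "steenrod i (mp_const c) = \<zero>\<^bsub>S\<^esub>"
        by (simp add: steenrod_const assms(3) invariant_ring_simps)
      then show "steenrod i (mp_const c) \<odot>\<^bsub>?H\<^esub> Q (n - i) x = \<zero>\<^bsub>?H\<^esub>"
        using that compatibleD(1)[OF Q] by simp
    qed auto
    then show ?thesis
      using that const compatibleD(1)[OF Q]
      by (simp add: compatibleD(3)[OF Q] twist_leading_term[OF H])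
  qed
  then have "cartan_module S ?H Q"
    using H by (auto simp: cartan_module_def compatibleD[OF Q] twist_def)
  then show ?thesis by blast
qed

end
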